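(* There is exactly one family of rational numbers $(c^{(k)}_\rho)$, indexed by integers $k\ge 0$ and partitions $\rho$, such that $c^{(0)}_\rho=\delta_{\rho,\emptyset}$ for every $\rho$, $c^{(k)}_\emptyset=0$ for every $k\ge1$, and for every $k\ge 1$ and every partition $\rho$ the two recurrence relations \[c^{(k)}_{\rho\cup (1)}=\sum_{r \ge 1} r\,m_r(\rho) \,c^{(k-1)}_{\rho\setminus (r) \cup(r+1)},\] \[\begin{aligned} \sum_{r \ge 1} r\,m_r(\rho) \,c^{(k)}_{\rho\setminus (r) \cup(r+1)}={}& 2|\rho|\,c^{(k-1)}_\rho +m_1(\rho)\,c^{(k-1)}_{\rho\setminus (1)} +\sum_{r,s \ge 1} rs\,m_r(\rho)(m_s(\rho)-\delta_{rs})\, c_{\rho \setminus (r,s)\cup (r+s+1)}^{(k-1)}\\ &+\sum_{r,s \ge 1} (r+s-1)\,m_{r+s-1}(\rho)\, c_{\rho \setminus (r+s-1)\cup (r,s)}^{(k-1)} \end{aligned}\] hold. For this family (whose members do not depend on $n$), for every $k\ge0$ and every $n\ge 1$, \[h_k(J_1,\ldots,J_n)=\sum_{|\rho|\le n}c^{(k)}_\rho \, \binom{n-|\overline{\rho}|}{m_1(\rho)} \, C_{\tilde{\rho}}\qquad\text{in } \mathbb{C}[S_n].\]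
   Context: $h_k$ is the complete homogeneous symmetric function ($h_0=1$). For $1\le i\le n$, the Jucys-Murphy element is $J_i=\sum_{1\le j<i}(j\,i)\in\mathbb{C}[S_n]$ (sum of transpositions; $J_1=0$); these commute. For a partition $\mu$ of $n$, $C_\mu\in\mathbb{C}[S_n]$ is the sum of all permutations of cycle-type $\mu$. For a partition $\rho$: $|\rho|$ is its weight, $m_i(\rho)$ the multiplicity of the part $i$; $\overline{\rho}$ is $\rho$ with all parts $1$ erased; for $n\ge|\rho|$, $\tilde\rho=\rho\cup 1^{n-|\rho|}$ is $\rho$ with parts $1$ added up to weight $n$. $\emptyset$ is the empty partition. $\rho\setminus(p)\cup(q)$ denotes the partition obtained from $\rho$ by removing one part $p$ and adding one part $q$ (similarly $\rho\setminus(r,s)\cup(q)$, $\rho\setminus(p)\cup(r,s)$, $\rho\cup(1)$, $\rho\setminus(1)$); terms in which such a partition does not exist are $0$. Sums over $r,s\ge1$ are over ordered pairs. *)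

theory Defs
  imports Complex_Main "HOL-Library.Multiset" "HOL-Library.Poly_Mapping" "HOL-Combinatorics.Perm"
begin

section \<open>The group algebra of the symmetric groups\<close>

text \<open>
  The ring structure of \<open>'g \<Rightarrow>\<^sub>0 complex\<close> from \<open>Poly_Mapping\<close> is the convolution product, i.e. the
  complex monoid algebra of \<open>'g\<close>, but it expects the (not necessarily commutative) monoid \<open>'g\<close> to
  be written additively. The wrapper below rewrites a multiplicative monoid additively.
\<close>

datatype 'a additive = Additive (unAdditive: 'a)

instantiation additive :: (monoid_mult) monoid_add
begin

definition zero_additive :: "'a additive" where
  "0 = Additive 1"

definition plus_additive :: "'a additive \<Rightarrow> 'a additive \<Rightarrow> 'a additive" where
  "x + y = Additive (unAdditive x * unAdditive y)"

instance
  by standard (simp_all add: zero_additive_def plus_additive_def mult.assoc)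

end

type_synonym 'g group_algebra = "'g additive \<Rightarrow>\<^sub>0 complex"

definition basis :: "'g \<Rightarrow> 'g group_algebra" where
  "basis g = Poly_Mapping.single (Additive g) 1"

definition scale :: "complex \<Rightarrow> 'g group_algebra \<Rightarrow> 'g group_algebra" where
  "scale a x = Poly_Mapping.map ((*) a) x"

text \<open>
  \<open>S\<^sub>n\<close> consists of the permutations of the natural numbers that fix every point outside \<open>{1..n}\<close>,
  and the group algebra \<open>\<complex>[S\<^sub>n]\<close> is the subalgebra \<open>sym_algebra n\<close> spanned by it inside the group
  algebra of all finitely supported permutations.
\<close>

definition sym_group :: "nat \<Rightarrow> nat perm set" where
  "sym_group n = {p. affected p \<subseteq> {1..n}}"

definition sym_algebra :: "nat \<Rightarrow> nat perm group_algebra set" where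
  "sym_algebra n = {x. Poly_Mapping.keys x \<subseteq> Additive ` sym_group n}"

definition jucys_murphy :: "nat \<Rightarrow> nat perm group_algebra" where
  "jucys_murphy i = (\<Sum>j\<in>{1..<i}. basis (Perm.swap j i))"

text \<open>
  The complete homogeneous symmetric function
  \<open>h\<^sub>k(x\<^sub>1, \<dots>, x\<^sub>n) = \<Sum> x\<^bsub>i\<^sub>1\<^esub> \<cdots> x\<^bsub>i\<^sub>k\<^esub>\<close>, the sum being over \<open>1 \<le> i\<^sub>1 \<le> \<dots> \<le> i\<^sub>k \<le> n\<close>. The factors
  are multiplied in this order because the ring need not be commutative; for commuting
  arguments the order is irrelevant.
\<close>

definition complete_homogeneous :: "nat \<Rightarrow> nat \<Rightarrow> (nat \<Rightarrow> 'a::semiring_1) \<Rightarrow> 'a" where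
  "complete_homogeneous k n x =
     (\<Sum>is | length is = k \<and> sorted is \<and> set is \<subseteq> {1..n}. prod_list (map x is))"


section \<open>Partitions\<close>

definition is_partition :: "nat multiset \<Rightarrow> bool" where
  "is_partition \<rho> \<longleftrightarrow> 0 \<notin># \<rho>"

abbreviation weight :: "nat multiset \<Rightarrow> nat" where
  "weight \<rho> \<equiv> sum_mset \<rho>"

definition reduced :: "nat multiset \<Rightarrow> nat multiset" where
  "reduced \<rho> = filter_mset (\<lambda>i. i \<noteq> 1) \<rho>"

definition completed :: "nat \<Rightarrow> nat multiset \<Rightarrow> nat multiset" where
  "completed n \<rho> = \<rho> + replicate_mset (n - weight \<rho>) 1"

definition cycle_type :: "nat \<Rightarrow> nat perm \<Rightarrow> nat multiset" where
  "cycle_type n p = image_mset card (mset_set (Perm.orbit p ` {1..n}))"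

definition class_sum :: "nat \<Rightarrow> nat multiset \<Rightarrow> nat perm group_algebra" where
  "class_sum n \<mu> = (\<Sum>p | p \<in> sym_group n \<and> cycle_type n p = \<mu>. basis p)"


section \<open>The recurrence relations\<close>

text \<open>
  A family indexed by partitions is a function on \<open>nat multiset\<close> that vanishes on multisets which
  are not partitions. Sums over \<open>r\<close> and \<open>s\<close> run up to \<open>|\<rho>|\<close>: a multiplicity \<open>m\<^sub>r(\<rho>)\<close> with \<open>r > |\<rho>|\<close>
  is \<open>0\<close>, and \<open>r + s - 1 \<le> |\<rho>|\<close> forces \<open>r, s \<le> |\<rho>|\<close>. Multiset subtraction removes only parts that
  are present, so \<open>\<rho> - {#r, s#}\<close> is meaningless when \<open>\<rho>\<close> does not contain \<open>r, s\<close>; the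
  coefficient in front of such a term is \<open>0\<close>.
\<close>

definition recurrence_family :: "(nat \<Rightarrow> nat multiset \<Rightarrow> rat) \<Rightarrow> bool" where
  "recurrence_family c \<longleftrightarrow>
     (\<forall>k \<rho>. \<not> is_partition \<rho> \<longrightarrow> c k \<rho> = 0) \<and>
     (\<forall>\<rho>. is_partition \<rho> \<longrightarrow> c 0 \<rho> = (if \<rho> = {#} then 1 else 0)) \<and>
     (\<forall>k\<ge>1. c k {#} = 0) \<and>
     (\<forall>k\<ge>1. \<forall>\<rho>. is_partition \<rho> \<longrightarrow>
        c k (\<rho> + {#1#}) =
          (\<Sum>r=1..weight \<rho>. of_nat r * of_nat (count \<rho> r) * c (k - 1) (\<rho> - {#r#} + {#r + 1#}))) \<and>
     (\<forall>k\<ge>1. \<forall>\<rho>. is_partition \<rho> \<longrightarrow>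
        (\<Sum>r=1..weight \<rho>. of_nat r * of_nat (count \<rho> r) * c k (\<rho> - {#r#} + {#r + 1#})) =
          2 * of_nat (weight \<rho>) * c (k - 1) \<rho>
          + of_nat (count \<rho> 1) * c (k - 1) (\<rho> - {#1#})
          + (\<Sum>r=1..weight \<rho>. \<Sum>s=1..weight \<rho>.
               of_nat r * of_nat s * of_nat (count \<rho> r)
               * (of_nat (count \<rho> s) - (if r = s then 1 else 0))
               * c (k - 1) (\<rho> - {#r, s#} + {#r + s + 1#}))
          + (\<Sum>r=1..weight \<rho>. \<Sum>s=1..weight \<rho>.
               of_nat (r + s - 1) * of_nat (count \<rho> (r + s - 1))
               * c (k - 1) (\<rho> - {#r + s - 1#} + {#r, s#})))"


section \<open>All elements involved belong to \<open>\<complex>[S\<^sub>n]\<close>\<close>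

lemma basis_in_sym_algebra: "p \<in> sym_group n \<Longrightarrow> basis p \<in> sym_algebra n"
  by (simp add: basis_def sym_algebra_def)

lemma zero_in_sym_algebra: "0 \<in> sym_algebra n"
  by (simp add: sym_algebra_def)

lemma one_in_sym_algebra: "1 \<in> sym_algebra n"
  by (simp add: sym_algebra_def sym_group_def zero_additive_def)

lemma add_in_sym_algebra: "x \<in> sym_algebra n \<Longrightarrow> y \<in> sym_algebra n \<Longrightarrow> x + y \<in> sym_algebra n"
  unfolding sym_algebra_def using Poly_Mapping.keys_add[of x y] by blast

lemma scale_in_sym_algebra: "x \<in> sym_algebra n \<Longrightarrow> scale a x \<in> sym_algebra n"
  unfolding sym_algebra_def scale_def
  by (force simp: Poly_Mapping.in_keys_iff Poly_Mapping.map.rep_eq when_def split: if_splits)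

lemma sum_in_sym_algebra:
  "(\<And>i. i \<in> A \<Longrightarrow> f i \<in> sym_algebra n) \<Longrightarrow> (\<Sum>i\<in>A. f i) \<in> sym_algebra n"
  by (induction A rule: infinite_finite_induct) (simp_all add: zero_in_sym_algebra add_in_sym_algebra)

lemma mult_in_sym_algebra:
  assumes "x \<in> sym_algebra n" "y \<in> sym_algebra n"
  shows "x * y \<in> sym_algebra n"
proof -
  have "p * q \<in> sym_group n" if "p \<in> sym_group n" "q \<in> sym_group n" for p q
    using that affected_times[of p q] unfolding sym_group_def by blast
  then have "a + b \<in> Additive ` sym_group n"
    if "a \<in> Poly_Mapping.keys x" "b \<in> Poly_Mapping.keys y" for a b
    using that assms by (force simp: sym_algebra_def plus_additive_def)
  then show ?thesis
    using Poly_Mapping.keys_mult[of x y] by (auto simp: sym_algebra_def)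
qed

lemma jucys_murphy_in_sym_algebra:
  assumes "i \<le> n"
  shows "jucys_murphy i \<in> sym_algebra n"
  unfolding jucys_murphy_def using assms
  by (intro sum_in_sym_algebra basis_in_sym_algebra) (auto simp: sym_group_def affected_swap)

lemma complete_homogeneous_in_sym_algebra:
  "complete_homogeneous k n jucys_murphy \<in> sym_algebra n"
proof -
  have "prod_list (map jucys_murphy is) \<in> sym_algebra n" if "set is \<subseteq> {1..n}" for "is"
    using that by (induction "is")
      (auto simp: one_in_sym_algebra mult_in_sym_algebra jucys_murphy_in_sym_algebra)
  then show ?thesis
    unfolding complete_homogeneous_def by (intro sum_in_sym_algebra) auto
qed

lemma class_sum_in_sym_algebra: "class_sum n \<mu> \<in> sym_algebra n"
  unfolding class_sum_def by (intro sum_in_sym_algebra basis_in_sym_algebra) auto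

end

theory Submission
  imports Defs "HOL-Combinatorics.Permutations"
begin

text \<open>
  Write \<open>h\<^sub>k(J\<^sub>1, \<dots>, J\<^sub>n) = \<Sum>\<^sub>w a\<^sub>k(w) w\<close>. The coefficient \<open>a\<^sub>k(w)\<close> depends only on the cycle type
  \<open>\<mu>\<close> of \<open>w\<close> as a permutation of \<open>n = |\<mu>|\<close> points, and both recurrences are the image, under binomial
  inversion in the number of parts \<open>1\<close>, of two relations between these numbers \<open>a\<^sub>k(\<mu>)\<close>.

  The relations for \<open>a\<close> come from \<open>h\<^bsub>k+1\<^esub>(n) = h\<^bsub>k+1\<^esub>(n-1) + h\<^sub>k(n) J\<^sub>n\<close>. Comparing coefficients at a
  permutation \<open>w\<close> in which \<open>n\<close> lies on a cycle of length \<open>p\<close>, the products of \<open>w\<close> with the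
  transpositions \<open>(j n)\<close> split that cycle into \<open>i\<close> and \<open>p - i\<close> points, once for each \<open>0 < i < p\<close>, or join
  it with another cycle of length \<open>r\<close>, in \<open>r\<close> ways (\<open>sum_cycle_type_times_swap\<close>). If \<open>p \<ge> 2\<close> the term
  \<open>h\<^bsub>k+1\<^esub>(n-1)\<close> does not contribute, and this expresses \<open>a\<^bsub>k+1\<^esub>(\<mu>)\<close> for any part \<open>p \<ge> 2\<close> of \<open>\<mu>\<close>
  (\<open>class_coeff_add_part\<close>); if \<open>p = 1\<close> it gives the difference of \<open>a\<^bsub>k+1\<^esub>\<close> at \<open>\<mu> \<union> (1)\<close> and \<open>\<mu>\<close>
  (\<open>class_coeff_add_one\<close>). That \<open>p\<close> may be any part rests on centrality: \<open>h\<^sub>k(n)\<close> commutes with all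
  transpositions in \<open>S\<^sub>n\<close> (\<open>complete_homogeneous_jucys_murphy_central\<close>), so the point \<open>n\<close> can be moved
  to any cycle by conjugation. The same step shows by induction that \<open>a\<^sub>k(w)\<close> is a function of the
  cycle type (\<open>h_coeff_eq_class_coeff\<close>).

  The theorem asserts that \<open>a\<^sub>k = T c\<^sub>k\<close> with \<open>(T f)(\<mu>) = \<Sum>\<^sub>j (m\<^sub>1(\<mu>) choose j) f(\<mu>' \<union> 1\<^sup>j)\<close>, where
  \<open>\<mu>'\<close> is \<open>\<mu>\<close> without its parts \<open>1\<close>. The linear map \<open>T\<close> (\<open>ones_transform\<close>) is injective. With
  \<open>(D f)(\<rho>) = f(\<rho> \<union> (1))\<close> (\<open>add_part 1\<close>), Pascal's rule says \<open>D T = T (1 + D)\<close>. From it follow, by induction on the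
  number of parts \<open>1\<close>, the rules for moving \<open>T\<close> past the operators that raise a part, join two parts and
  split a part: raising and joining commute with \<open>T\<close>, and splitting picks up exactly the two extra
  terms \<open>2|\<rho>| c(\<rho>) + m\<^sub>1(\<rho>) c(\<rho> \<setminus> (1))\<close> of the second recurrence (\<open>ones_transform_split_part\<close>). So
  the relations for \<open>a\<close> translate into those for \<open>c\<close> (\<open>recurrence_family_exists\<close>).

  Uniqueness is direct: by induction on \<open>q\<close>, the two recurrences determine \<open>c\<^sub>k\<close> at every partition that
  has a part \<open>q\<close> (\<open>raise_part_eq_0_imp_eq_0\<close>).
\<close>

unbundle permutation_syntax

section \<open>Operators on functions of partitions\<close>

lemma sum_mset_cong:
  assumes "\<And>x. x \<in># M \<Longrightarrow> f x = g x"
  shows "(\<Sum>x\<in>#M. f x) = (\<Sum>x\<in>#M. g x)"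
  by (intro arg_cong[where f=sum_mset] image_mset_cong assms)

definition add_part :: "nat \<Rightarrow> (nat multiset \<Rightarrow> rat) \<Rightarrow> nat multiset \<Rightarrow> rat" where
  "add_part q f \<rho> = f (add_mset q \<rho>)"

text \<open>
  The sum runs over the parts with multiplicity, so that it carries the factor \<open>m\<^sub>r(\<rho>)\<close>. The factor
  \<open>r\<close> annihilates an entry \<open>0\<close>, so that for \<open>q \<ge> 1\<close> raising never produces a part \<open>1\<close>.
\<close>
definition raise_part :: "nat \<Rightarrow> (nat multiset \<Rightarrow> rat) \<Rightarrow> nat multiset \<Rightarrow> rat" where
  "raise_part q f \<rho> = (\<Sum>r\<in>#\<rho>. of_nat r * f (add_mset (r + q) (\<rho> - {#r#})))"

text \<open>
  The inner operator runs over \<open>\<rho>\<close> without the chosen part \<open>r\<close>, which accounts for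
  \<open>m\<^sub>s(\<rho>) - \<delta>\<^sub>r\<^sub>s\<close>; it turns \<open>s\<close> into \<open>s + (r + 1)\<close>.
\<close>
definition join_parts :: "(nat multiset \<Rightarrow> rat) \<Rightarrow> nat multiset \<Rightarrow> rat" where
  "join_parts f \<rho> = (\<Sum>r\<in>#\<rho>. of_nat r * raise_part (r + 1) f (\<rho> - {#r#}))"

definition split_part :: "(nat multiset \<Rightarrow> rat) \<Rightarrow> nat multiset \<Rightarrow> rat" where
  "split_part f \<rho> = (\<Sum>p\<in>#\<rho>. of_nat p * (\<Sum>i=1..p. f (add_mset i (add_mset (p + 1 - i) (\<rho> - {#p#})))))"

text \<open>
  With \<open>T\<close> the transform below, this is \<open>T\<^bsup>-1\<^esup> split_part T\<close>; the two additional terms are those of the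
  second recurrence.
\<close>
definition twisted_split_part :: "(nat multiset \<Rightarrow> rat) \<Rightarrow> nat multiset \<Rightarrow> rat" where
  "twisted_split_part f \<rho> = split_part f \<rho> + 2 * of_nat (weight \<rho>) * f \<rho> + of_nat (count \<rho> 1) * f (\<rho> - {#1#})"

text \<open>
  The coefficient of a permutation of cycle type \<open>\<mu>\<close> in the asserted expansion of \<open>h\<^sub>k\<close> is \<open>ones_transform (c k) \<mu>\<close>.
\<close>
definition ones_transform :: "(nat multiset \<Rightarrow> rat) \<Rightarrow> nat multiset \<Rightarrow> rat" where
  "ones_transform f \<mu> =
     (\<Sum>j\<le>count \<mu> 1. of_nat (count \<mu> 1 choose j) * f (reduced \<mu> + replicate_mset j 1))"

lemma reduced_add_mset [simp]:
  "reduced (add_mset q \<mu>) = (if q = 1 then reduced \<mu> else add_mset q (reduced \<mu>))"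
  by (simp add: reduced_def)

lemma reduced_plus_ones: "reduced \<mu> + replicate_mset (count \<mu> 1) 1 = \<mu>"
  by (rule multiset_eqI) (auto simp: reduced_def)

lemma reduced_plus_replicate: "reduced (\<rho> + replicate_mset j 1) = reduced \<rho>"
  by (rule multiset_eqI) (simp add: reduced_def)

lemma weight_eq_reduced: "weight \<mu> = weight (reduced \<mu>) + count \<mu> 1"
  by (subst reduced_plus_ones[of \<mu>, symmetric]) (simp only: sum_mset.union sum_mset_replicate_mset, simp)

lemma ones_induct [case_names no_ones add_one]:
  assumes "\<And>\<mu>. count \<mu> 1 = 0 \<Longrightarrow> P \<mu>" "\<And>\<mu>. P \<mu> \<Longrightarrow> P (add_mset 1 \<mu>)"
  shows "P (\<mu> :: nat multiset)"
proof (induction "count \<mu> 1" arbitrary: \<mu>)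
  case 0
  then show ?case using assms(1) by simp
next
  case (Suc m)
  then have "1 \<in># \<mu>" by (metis count_greater_zero_iff zero_less_Suc)
  then obtain \<nu> where \<nu>: "\<mu> = add_mset 1 \<nu>" by (metis insert_DiffM)
  then show ?case using Suc assms(2)[of \<nu>] by simp
qed

lemma ones_transform_no_ones:
  assumes "count \<mu> 1 = 0"
  shows "ones_transform f \<mu> = f \<mu>"
  using assms reduced_plus_ones[of \<mu>] by (simp add: ones_transform_def)

lemma ones_transform_cong:
  assumes "\<And>\<rho>. reduced \<rho> = reduced \<mu> \<Longrightarrow> f \<rho> = g \<rho>"
  shows "ones_transform f \<mu> = ones_transform g \<mu>"
proof -
  have "reduced (reduced \<mu> + replicate_mset j 1) = reduced \<mu>" for j
    unfolding reduced_plus_replicate by (rule multiset_eqI) (simp add: reduced_def)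
  then show ?thesis unfolding ones_transform_def using assms by (intro sum.cong) auto
qed

lemma ones_transform_add:
  "ones_transform (\<lambda>\<rho>. f \<rho> + g \<rho>) \<mu> = ones_transform f \<mu> + ones_transform g \<mu>"
  by (simp add: ones_transform_def sum.distrib algebra_simps)

lemma ones_transform_mult:
  "ones_transform (\<lambda>\<rho>. x * f \<rho>) \<mu> = x * ones_transform f \<mu>"
  by (simp add: ones_transform_def sum_distrib_left algebra_simps)

text \<open>This is Pascal's rule. It drives all inductions on the number of parts \<open>1\<close> below.\<close>
lemma ones_transform_add_one:
  "ones_transform f (add_mset 1 \<mu>) = ones_transform f \<mu> + ones_transform (add_part 1 f) \<mu>"
proof -
  define m where "m = count \<mu> 1"
  define g where "g j = f (reduced \<mu> + replicate_mset j 1)" for j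
  have "(\<Sum>j\<le>Suc m. of_nat (Suc m choose j) * g j) =
     g 0 + (\<Sum>j\<le>m. of_nat (Suc m choose Suc j) * g (Suc j))"
    by (subst sum.atMost_Suc_shift) simp
  also have "\<dots> = g 0 + (\<Sum>j\<le>m. of_nat (m choose Suc j) * g (Suc j)) + (\<Sum>j\<le>m. of_nat (m choose j) * g (Suc j))"
    by (simp add: sum.distrib algebra_simps)
  also have "g 0 + (\<Sum>j\<le>m. of_nat (m choose Suc j) * g (Suc j)) = (\<Sum>j\<le>Suc m. of_nat (m choose j) * g j)"
    by (subst sum.atMost_Suc_shift) simp
  also have "\<dots> = (\<Sum>j\<le>m. of_nat (m choose j) * g j)"
    by simp
  finally show ?thesis
    by (simp add: ones_transform_def m_def g_def add_part_def)
qed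

lemma ones_transform_add_part:
  assumes "q \<noteq> 1"
  shows "ones_transform f (add_mset q \<mu>) = ones_transform (add_part q f) \<mu>"
  using assms by (simp add: ones_transform_def add_part_def)

text \<open>
  The map is unitriangular for the number of parts \<open>1\<close>: the summand \<open>j = count \<rho> 1\<close> is \<open>f \<rho>\<close>, the
  others involve fewer parts \<open>1\<close>.
\<close>
lemma ones_transform_inj:
  assumes "\<And>\<mu>. is_partition \<mu> \<Longrightarrow> ones_transform f \<mu> = ones_transform g \<mu>" "is_partition \<rho>"
  shows "f \<rho> = g \<rho>"
  using assms(2)
proof (induction "count \<rho> 1" arbitrary: \<rho> rule: less_induct)
  case less
  have top: "ones_transform h \<rho> =
      h \<rho> + (\<Sum>j<count \<rho> 1. of_nat (count \<rho> 1 choose j) * h (reduced \<rho> + replicate_mset j 1))" for h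
    by (simp add: ones_transform_def reduced_plus_ones[simplified] flip: lessThan_Suc_atMost)
  have "f (reduced \<rho> + replicate_mset j 1) = g (reduced \<rho> + replicate_mset j 1)" if "j < count \<rho> 1" for j
    using that less by (intro less) (auto simp: is_partition_def reduced_def)
  then show ?case using assms(1)[OF less(2)] by (simp add: top)
qed

lemma raise_part_add_one:
  "raise_part q f (add_mset 1 \<rho>) = f (add_mset (q + 1) \<rho>) + raise_part q (add_part 1 f) \<rho>"
proof -
  have "(\<Sum>r\<in>#\<rho>. of_nat r * f (add_mset (r + q) (add_mset 1 \<rho> - {#r#}))) =
        (\<Sum>r\<in>#\<rho>. of_nat r * f (add_mset 1 (add_mset (r + q) (\<rho> - {#r#}))))"
    by (intro sum_mset_cong) (auto simp: add_mset_commute)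
  then show ?thesis by (simp add: raise_part_def add_part_def)
qed

lemma join_parts_add_one:
  "join_parts f (add_mset 1 \<rho>) = join_parts (add_part 1 f) \<rho> + 2 * raise_part 2 f \<rho>"
proof -
  have "(\<Sum>r\<in>#\<rho>. of_nat r * raise_part (r + 1) f (add_mset 1 \<rho> - {#r#})) =
        (\<Sum>r\<in>#\<rho>. of_nat r * raise_part (r + 1) f (add_mset 1 (\<rho> - {#r#})))"
    by (intro sum_mset_cong) auto
  also have "\<dots> = raise_part 2 f \<rho> + join_parts (add_part 1 f) \<rho>"
    unfolding raise_part_add_one
    by (simp add: raise_part_def[of 2] join_parts_def sum_mset.distrib algebra_simps)
  finally show ?thesis by (simp add: join_parts_def numeral_2_eq_2)
qed

lemma split_part_add_one:
  "split_part f (add_mset 1 \<rho>) = split_part (add_part 1 f) \<rho> + add_part 1 (add_part 1 f) \<rho>"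
proof -
  have "(\<Sum>p\<in>#\<rho>. of_nat p * (\<Sum>i=1..p. f (add_mset i (add_mset (p + 1 - i) (add_mset 1 \<rho> - {#p#}))))) =
        (\<Sum>p\<in>#\<rho>. of_nat p * (\<Sum>i=1..p. f (add_mset 1 (add_mset i (add_mset (p + 1 - i) (\<rho> - {#p#}))))))"
    by (intro sum_mset_cong) (auto simp: add_mset_commute)
  then show ?thesis by (simp add: split_part_def add_part_def)
qed

lemma twisted_split_part_add_one:
  "twisted_split_part f (add_mset 1 \<rho>) =
     twisted_split_part (add_part 1 f) \<rho> + add_part 1 (add_part 1 f) \<rho> + 2 * add_part 1 f \<rho> + f \<rho>"
proof -
  have "of_nat (count \<rho> 1) * f (add_mset 1 (\<rho> - {#1#})) = of_nat (count \<rho> 1) * f \<rho>"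
    by (cases "1 \<in># \<rho>") (auto simp: not_in_iff simp del: One_nat_def)
  then show ?thesis
    unfolding twisted_split_part_def split_part_add_one by (auto simp: add_part_def algebra_simps)
qed

lemma add_part_add:
  "add_part q (\<lambda>\<rho>. f \<rho> + g \<rho>) = (\<lambda>\<rho>. add_part q f \<rho> + add_part q g \<rho>)"
  by (simp add: add_part_def fun_eq_iff)

lemma raise_part_add:
  "raise_part q (\<lambda>\<rho>. f \<rho> + g \<rho>) \<rho> = raise_part q f \<rho> + raise_part q g \<rho>"
  by (simp add: raise_part_def sum_mset.distrib algebra_simps)

lemma join_parts_add:
  "join_parts (\<lambda>\<rho>. f \<rho> + g \<rho>) \<rho> = join_parts f \<rho> + join_parts g \<rho>"
  by (simp add: join_parts_def raise_part_add sum_mset.distrib algebra_simps)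

lemma split_part_add:
  "split_part (\<lambda>\<rho>. f \<rho> + g \<rho>) \<rho> = split_part f \<rho> + split_part g \<rho>"
  by (simp add: split_part_def sum.distrib sum_mset.distrib algebra_simps)

lemma add_part_1_ones_transform:
  "add_part 1 (ones_transform f) = (\<lambda>\<rho>. ones_transform f \<rho> + ones_transform (add_part 1 f) \<rho>)"
  by (rule ext) (simp only: add_part_def[of 1 "ones_transform f"] ones_transform_add_one)

lemma add_part_1_raise_part:
  "add_part 1 (raise_part q f) = (\<lambda>\<rho>. add_part (q + 1) f \<rho> + raise_part q (add_part 1 f) \<rho>)"
  by (rule ext) (simp only: add_part_def[of 1 "raise_part q f"] add_part_def[of "q+1"] raise_part_add_one)

lemma add_part_1_join_parts:
  "add_part 1 (join_parts f) = (\<lambda>\<rho>. join_parts (add_part 1 f) \<rho> + 2 * raise_part 2 f \<rho>)"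
  by (rule ext) (simp only: add_part_def[of 1 "join_parts f"] join_parts_add_one)

lemma add_part_1_twisted_split_part:
  "add_part 1 (twisted_split_part f) = (\<lambda>\<rho>. twisted_split_part (add_part 1 f) \<rho> + add_part 1 (add_part 1 f) \<rho>
      + 2 * add_part 1 f \<rho> + f \<rho>)"
  by (rule ext) (simp only: add_part_def[of 1 "twisted_split_part f"] twisted_split_part_add_one)

text \<open>
  A raised part has size at least \<open>2\<close>, so both sides agree where there are no parts \<open>1\<close>. The commutator
  of raising with \<open>add_part 1\<close> is \<open>add_part (q + 1)\<close>, which commutes with the transform; so the two sides
  change in the same way when a part \<open>1\<close> is added.
\<close>
lemma ones_transform_raise_part:
  assumes "q \<ge> 1"
  shows "ones_transform (raise_part q f) \<mu> = raise_part q (ones_transform f) \<mu>"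
proof (induction \<mu> arbitrary: f rule: ones_induct)
  case (no_ones \<mu>)
  have "of_nat r * f (add_mset (r + q) (\<mu> - {#r#})) = of_nat r * ones_transform f (add_mset (r + q) (\<mu> - {#r#}))"
    if "r \<in># \<mu>" for r
    using assms no_ones by (cases r) (auto intro!: ones_transform_no_ones[symmetric])
  then show ?case
    unfolding ones_transform_no_ones[OF no_ones] raise_part_def by (intro sum_mset_cong)
next
  case (add_one \<mu>)
  have "ones_transform f (add_mset (q + 1) \<mu>) = ones_transform (add_part (q + 1) f) \<mu>"
    using assms by (intro ones_transform_add_part) simp
  then show ?case
    by (simp only: ones_transform_add_one raise_part_add_one add_part_1_raise_part
        add_part_1_ones_transform ones_transform_add raise_part_add add_one)
qed

lemma ones_transform_join_parts:
  "ones_transform (join_parts f) \<mu> = join_parts (ones_transform f) \<mu>"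
proof (induction \<mu> arbitrary: f rule: ones_induct)
  case (no_ones \<mu>)
  have "of_nat r * raise_part (r + 1) f (\<mu> - {#r#}) = of_nat r * raise_part (r + 1) (ones_transform f) (\<mu> - {#r#})"
    if "r \<in># \<mu>" for r
  proof -
    have "count (\<mu> - {#r#}) 1 = 0" using no_ones by simp
    then show ?thesis
      using ones_transform_raise_part[of "r + 1" f "\<mu> - {#r#}"] ones_transform_no_ones[of "\<mu> - {#r#}"]
      by simp
  qed
  then show ?case
    unfolding ones_transform_no_ones[OF no_ones] join_parts_def by (intro sum_mset_cong)
next
  case (add_one \<mu>)
  have "ones_transform (raise_part 2 f) \<mu> = raise_part 2 (ones_transform f) \<mu>"
    by (rule ones_transform_raise_part) simp
  then show ?case
    by (simp only: ones_transform_add_one join_parts_add_one add_part_1_join_parts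
        add_part_1_ones_transform ones_transform_add ones_transform_mult join_parts_add add_one)
qed

text \<open>
  Splitting creates parts \<open>1\<close>: a part \<open>p \<ge> 2\<close> can be turned into \<open>(1, p)\<close> and \<open>(p, 1)\<close>. If there are
  no parts \<open>1\<close> yet, each of these two terms contributes an additional \<open>p f(\<mu>)\<close>, in total
  \<open>2|\<mu>| f(\<mu>)\<close>. The term with \<open>m\<^sub>1\<close> then comes from the commutator with \<open>add_part 1\<close>, which is
  \<open>(1 + D)\<^sup>2\<close> for the twisted operator and \<open>D\<^sup>2\<close> for the plain one, where \<open>D = add_part 1\<close>.
\<close>
lemma ones_transform_split_part:
  "split_part (ones_transform f) \<mu> = ones_transform (twisted_split_part f) \<mu>"
proof (induction \<mu> arbitrary: f rule: ones_induct)
  case (no_ones \<mu>)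
  have *: "of_nat p * (\<Sum>i=1..p. ones_transform f (add_mset i (add_mset (p + 1 - i) (\<mu> - {#p#})))) =
        of_nat p * (\<Sum>i=1..p. f (add_mset i (add_mset (p + 1 - i) (\<mu> - {#p#})))) + 2 * of_nat p * f \<mu>"
    if p: "p \<in># \<mu>" for p
  proof (cases "p = 0")
    case False
    then have p2: "p \<ge> 2" using p no_ones by (metis One_nat_def Suc_leI count_eq_zero_iff le_neq_implies_less not_gr_zero Suc_1)
    have m: "count (\<mu> - {#p#}) 1 = 0" using no_ones by simp
    \<comment> \<open>Only the first and the last summand involve a part \<open>1\<close>.\<close>
    have ends: "{1..p} = insert 1 (insert p {2..<p})" using p2 by auto
    have "ones_transform f (add_mset i (add_mset (p + 1 - i) (\<mu> - {#p#}))) =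
       f (add_mset i (add_mset (p + 1 - i) (\<mu> - {#p#})))" if "i \<in> {2..<p}" for i
      using that m by (intro ones_transform_no_ones) auto
    moreover have "ones_transform f (add_mset 1 \<mu>) = f (add_mset 1 \<mu>) + f \<mu>"
      by (simp only: ones_transform_add_one ones_transform_no_ones[OF no_ones] add_part_def)
    ultimately show ?thesis
      using p2 p unfolding ends
      by (simp add: algebra_simps add_mset_commute[of p 1] add_mset_commute[of p "Suc 0"])
  qed simp
  have "split_part (ones_transform f) \<mu> = split_part f \<mu> + (\<Sum>p\<in>#\<mu>. 2 * of_nat p * f \<mu>)"
    unfolding split_part_def sum_mset.distrib[symmetric]
    by (intro sum_mset_cong *)
  also have "(\<Sum>p\<in>#\<mu>. 2 * of_nat p * f \<mu>) = 2 * of_nat (weight \<mu>) * f \<mu>"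
    by (simp add: sum_mset_distrib_left sum_mset_distrib_right)
  finally show ?case
    using no_ones by (simp add: ones_transform_no_ones[OF no_ones] twisted_split_part_def)
next
  case (add_one \<mu>)
  show ?case
    by (simp only: ones_transform_add_one split_part_add_one add_part_1_twisted_split_part
        add_part_1_ones_transform ones_transform_add ones_transform_mult split_part_add add_part_add add_one)
qed

section \<open>The recurrence relations in operator form\<close>

lemma le_weight: "r \<in># \<rho> \<Longrightarrow> r \<le> weight (\<rho>::nat multiset)"
  by (auto dest!: multi_member_split)

lemma sum_count_eq_sum_mset:
  fixes g :: "nat \<Rightarrow> rat"
  assumes "\<And>r. r \<in># \<rho> \<Longrightarrow> r \<le> N"
  shows "(\<Sum>r=1..N. of_nat r * of_nat (count \<rho> r) * g r) = (\<Sum>r\<in>#\<rho>. of_nat r * g r)"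
  using assms
proof (induction \<rho>)
  case (add x \<rho>)
  have "(\<Sum>r=1..N. of_nat r * of_nat (count (add_mset x \<rho>) r) * g r) =
        (\<Sum>r=1..N. of_nat r * of_nat (count \<rho> r) * g r + (if r = x then of_nat x * g x else 0))"
    by (intro sum.cong) (auto simp: algebra_simps)
  also have "\<dots> = (\<Sum>r\<in>#\<rho>. of_nat r * g r) + (\<Sum>r=1..N. if r = x then of_nat x * g x else 0)"
    using add by (simp add: sum.distrib)
  also have "(\<Sum>r=1..N. if r = x then of_nat x * g x else 0) = of_nat x * g x"
    using add.prems[of x] by (cases x) auto
  finally show ?case by simp
qed simp

lemma raise_part_eq_sum:
  "(\<Sum>r=1..weight \<rho>. of_nat r * of_nat (count \<rho> r) * f (\<rho> - {#r#} + {#r + 1#})) = raise_part 1 f \<rho>"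
  by (subst sum_count_eq_sum_mset) (auto simp: raise_part_def le_weight)

lemma join_parts_eq_sum:
  "(\<Sum>r=1..weight \<rho>. \<Sum>s=1..weight \<rho>. of_nat r * of_nat s * of_nat (count \<rho> r)
      * (of_nat (count \<rho> s) - (if r = s then 1 else 0)) * f (\<rho> - {#r, s#} + {#r + s + 1#})) =
    join_parts f \<rho>"
proof -
  define g where "g r = raise_part (r + 1) f (\<rho> - {#r#})" for r
  have "(\<Sum>s=1..weight \<rho>. of_nat r * of_nat s * of_nat (count \<rho> r)
      * (of_nat (count \<rho> s) - (if r = s then 1 else 0)) * f (\<rho> - {#r, s#} + {#r + s + 1#})) =
     of_nat r * of_nat (count \<rho> r) * g r" for r
  proof (cases "r \<in># \<rho>")
    case True
    then have c: "rat_of_nat (count \<rho> s) - (if r = s then 1 else 0) = of_nat (count (\<rho> - {#r#}) s)" for s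
      by (auto simp: of_nat_diff Suc_le_eq)
    have "(\<Sum>s=1..weight \<rho>. of_nat s * of_nat (count (\<rho> - {#r#}) s) * f (\<rho> - {#r, s#} + {#r + s + 1#})) = g r"
      unfolding g_def raise_part_def
      by (subst sum_count_eq_sum_mset) (auto simp: le_weight in_diffD ac_simps intro!: sum_mset_cong)
    moreover have "(\<Sum>s=1..weight \<rho>. of_nat r * of_nat s * of_nat (count \<rho> r)
        * (of_nat (count \<rho> s) - (if r = s then 1 else 0)) * f (\<rho> - {#r, s#} + {#r + s + 1#})) =
      of_nat r * of_nat (count \<rho> r) *
        (\<Sum>s=1..weight \<rho>. of_nat s * of_nat (count (\<rho> - {#r#}) s) * f (\<rho> - {#r, s#} + {#r + s + 1#}))"
      by (simp only: c sum_distrib_left mult_ac)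
    ultimately show ?thesis by simp
  qed (simp add: not_in_iff)
  then have "(\<Sum>r=1..weight \<rho>. \<Sum>s=1..weight \<rho>. of_nat r * of_nat s * of_nat (count \<rho> r)
      * (of_nat (count \<rho> s) - (if r = s then 1 else 0)) * f (\<rho> - {#r, s#} + {#r + s + 1#})) =
     (\<Sum>r=1..weight \<rho>. of_nat r * of_nat (count \<rho> r) * g r)"
    by (intro sum.cong refl)
  also have "\<dots> = join_parts f \<rho>"
    by (subst sum_count_eq_sum_mset) (auto simp: g_def join_parts_def le_weight)
  finally show ?thesis .
qed

lemma split_part_eq_sum:
  "(\<Sum>r=1..weight \<rho>. \<Sum>s=1..weight \<rho>. of_nat (r + s - 1) * of_nat (count \<rho> (r + s - 1))
      * f (\<rho> - {#r + s - 1#} + {#r, s#})) = split_part f \<rho>"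
proof -
  define N where "N = weight \<rho>"
  define t where "t r s = of_nat (r + s - 1) * of_nat (count \<rho> (r + s - 1)) * f (\<rho> - {#r + s - 1#} + {#r, s#})" for r s
  have z: "t r s = 0" if "r + s - 1 > N" for r s
  proof -
    have "r + s - 1 \<notin># \<rho>" using that le_weight[of "r + s - 1" \<rho>] by (auto simp: N_def)
    then show ?thesis by (simp add: t_def not_in_iff)
  qed
  have "(\<Sum>r=1..N. \<Sum>s=1..N. t r s) = (\<Sum>(r,s)\<in>{1..N}\<times>{1..N}. t r s)"
    by (simp add: sum.cartesian_product)
  also have "\<dots> = (\<Sum>(r,s)\<in>{(r,s). r \<ge> 1 \<and> s \<ge> 1 \<and> r + s - 1 \<le> N}. t r s)"
    by (intro sum.mono_neutral_right) (auto simp: not_le intro!: z)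
  also have "\<dots> = (\<Sum>(p,i)\<in>(SIGMA p:{1..N}. {1..p}). t i (p + 1 - i))"
    by (rule sum.reindex_bij_witness[where j="\<lambda>(r,s). (r + s - 1, r)" and i="\<lambda>(p,i). (i, p + 1 - i)"]) auto
  also have "\<dots> = (\<Sum>p=1..N. \<Sum>i=1..p. t i (p + 1 - i))"
    by (simp add: sum.Sigma)
  also have "\<dots> = (\<Sum>p=1..N. of_nat p * of_nat (count \<rho> p) *
      (\<Sum>i=1..p. f (add_mset i (add_mset (p + 1 - i) (\<rho> - {#p#})))))"
    by (auto simp: t_def sum_distrib_left add_mset_commute intro!: sum.cong)
  also have "\<dots> = split_part f \<rho>"
    by (subst sum_count_eq_sum_mset) (auto simp: split_part_def le_weight N_def)
  finally show ?thesis by (simp add: N_def t_def)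
qed

lemma recurrence_family_iff:
  "recurrence_family c \<longleftrightarrow>
     (\<forall>k \<rho>. \<not> is_partition \<rho> \<longrightarrow> c k \<rho> = 0) \<and>
     (\<forall>\<rho>. is_partition \<rho> \<longrightarrow> c 0 \<rho> = (if \<rho> = {#} then 1 else 0)) \<and>
     (\<forall>k. c (Suc k) {#} = 0) \<and>
     (\<forall>k \<rho>. is_partition \<rho> \<longrightarrow> add_part 1 (c (Suc k)) \<rho> = raise_part 1 (c k) \<rho>) \<and>
     (\<forall>k \<rho>. is_partition \<rho> \<longrightarrow>
        raise_part 1 (c (Suc k)) \<rho> = twisted_split_part (c k) \<rho> + join_parts (c k) \<rho>)"
proof -
  have all: "(\<forall>k\<ge>1. P k) \<longleftrightarrow> (\<forall>k. P (Suc k))" for P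
    by (metis One_nat_def Suc_le_D Suc_le_mono zero_le)
  show ?thesis
    unfolding recurrence_family_def raise_part_eq_sum join_parts_eq_sum split_part_eq_sum all
    by (simp add: add_part_def twisted_split_part_def algebra_simps)
qed

lemma is_partition_simps [simp]:
  "is_partition {#}"
  "is_partition (add_mset r \<rho>) \<longleftrightarrow> r \<noteq> 0 \<and> is_partition \<rho>"
  by (auto simp: is_partition_def)

lemma is_partition_diff [simp]: "is_partition \<rho> \<Longrightarrow> is_partition (\<rho> - \<sigma>)"
  by (auto simp: is_partition_def dest: in_diffD)

lemma raise_part_cong:
  assumes "\<And>\<sigma>. is_partition \<sigma> \<Longrightarrow> f \<sigma> = g \<sigma>" "is_partition \<rho>"
  shows "raise_part q f \<rho> = raise_part q g \<rho>"
  unfolding raise_part_def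
proof (intro sum_mset_cong)
  fix r assume "r \<in># \<rho>"
  then have "r \<noteq> 0" using assms(2) by (metis is_partition_def)
  then show "of_nat r * f (add_mset (r + q) (\<rho> - {#r#})) = of_nat r * g (add_mset (r + q) (\<rho> - {#r#}))"
    using assms by simp
qed

lemma join_parts_cong:
  assumes "\<And>\<sigma>. is_partition \<sigma> \<Longrightarrow> f \<sigma> = g \<sigma>" "is_partition \<rho>"
  shows "join_parts f \<rho> = join_parts g \<rho>"
  unfolding join_parts_def
  by (intro sum_mset_cong arg_cong2[where f="(*)"] refl raise_part_cong) (use assms in auto)

lemma split_part_cong:
  assumes "\<And>\<sigma>. is_partition \<sigma> \<Longrightarrow> f \<sigma> = g \<sigma>" "is_partition \<rho>"
  shows "split_part f \<rho> = split_part g \<rho>"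
  unfolding split_part_def
  by (intro sum_mset_cong arg_cong2[where f="(*)"] refl sum.cong) (use assms in auto)

text \<open>
  By induction on \<open>q\<close>, \<open>e\<close> vanishes at every partition with a part \<open>q\<close>. If \<open>\<sigma>\<close> has a part \<open>q + 1\<close>,
  replace it by \<open>q\<close> to get \<open>\<rho>\<close>. Raising another part of \<open>\<rho>\<close> leaves a part \<open>q\<close>, so only the multiple of
  \<open>e \<sigma>\<close> survives in \<open>raise_part 1 e \<rho>\<close>.
\<close>
lemma raise_part_eq_0_imp_eq_0:
  assumes empty: "e {#} = 0"
    and add: "\<And>\<rho>. is_partition \<rho> \<Longrightarrow> add_part 1 e \<rho> = 0"
    and raise: "\<And>\<rho>. is_partition \<rho> \<Longrightarrow> raise_part 1 e \<rho> = 0"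
    and \<sigma>: "is_partition \<sigma>"
  shows "e \<sigma> = 0"
proof (cases "\<sigma> = {#}")
  case False
  have "e \<sigma> = 0" if "Suc q \<in># \<sigma>" "is_partition \<sigma>" for q \<sigma>
    using that
  proof (induction q arbitrary: \<sigma>)
    case 0
    then show ?case using add[of "\<sigma> - {#1#}"] by (simp add: add_part_def)
  next
    case (Suc q)
    define \<rho> where "\<rho> = add_mset (Suc q) (\<sigma> - {#Suc (Suc q)#})"
    have \<rho>: "is_partition \<rho>" using Suc.prems by (simp add: \<rho>_def)
    have "of_nat r * e (add_mset (r + 1) (\<rho> - {#r#})) = (if r = Suc q then of_nat r * e \<sigma> else 0)"
      if "r \<in># \<rho>" for r
    proof (cases "r = Suc q")
      case False
      then have "Suc q \<in># add_mset (r + 1) (\<rho> - {#r#})"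
        by (simp add: \<rho>_def)
      then show ?thesis using False \<rho> Suc.IH by simp
    qed (use Suc.prems in \<open>simp add: \<rho>_def\<close>)
    then have "raise_part 1 e \<rho> = (\<Sum>r\<in>#\<rho>. if r = Suc q then of_nat r * e \<sigma> else 0)"
      unfolding raise_part_def by (intro sum_mset_cong)
    also have "\<dots> = of_nat (count \<rho> (Suc q)) * (of_nat (Suc q) * e \<sigma>)"
      by (induction \<rho>) (auto simp: algebra_simps)
    finally have "of_nat (count \<rho> (Suc q)) * (of_nat (Suc q) * e \<sigma>) = 0"
      using raise[OF \<rho>] by simp
    moreover have "count \<rho> (Suc q) \<noteq> 0" by (simp add: \<rho>_def)
    ultimately show ?case by (simp del: of_nat_Suc)
  qed
  moreover obtain p where "p \<in># \<sigma>" using False by blast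
  moreover from this have "p \<noteq> 0" using \<sigma> by (metis is_partition_def)
  ultimately show ?thesis using \<sigma> by (metis not0_implies_Suc)
qed (simp add: empty)

lemma recurrence_familyD:
  assumes "recurrence_family c"
  shows "\<not> is_partition \<rho> \<Longrightarrow> c k \<rho> = 0"
    and "is_partition \<rho> \<Longrightarrow> c 0 \<rho> = (if \<rho> = {#} then 1 else 0)"
    and "c (Suc k) {#} = 0"
    and "is_partition \<rho> \<Longrightarrow> add_part 1 (c (Suc k)) \<rho> = raise_part 1 (c k) \<rho>"
    and "is_partition \<rho> \<Longrightarrow> raise_part 1 (c (Suc k)) \<rho> = twisted_split_part (c k) \<rho> + join_parts (c k) \<rho>"
  using assms unfolding recurrence_family_iff by blast+

lemma recurrence_family_unique:
  assumes c: "recurrence_family c" and d: "recurrence_family d"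
  shows "c = d"
proof (intro ext)
  fix k \<rho>
  note D = recurrence_familyD
  show "c k \<rho> = d k \<rho>"
  proof (induction k arbitrary: \<rho>)
    case 0
    then show ?case using D(1,2)[OF c] D(1,2)[OF d] by metis
  next
    case (Suc k)
    then have eq: "c k = d k" by (intro ext)
    define e where "e \<rho> = c (Suc k) \<rho> - d (Suc k) \<rho>" for \<rho>
    have "e \<rho> = 0" if "is_partition \<rho>"
      using _ _ _ that
    proof (rule raise_part_eq_0_imp_eq_0)
      show "e {#} = 0" by (simp add: e_def D(3)[OF c] D(3)[OF d])
      show "add_part 1 e \<sigma> = 0" if "is_partition \<sigma>" for \<sigma>
        using D(4)[OF c that, of k] D(4)[OF d that, of k] by (simp add: e_def eq add_part_def)
      show "raise_part 1 e \<sigma> = 0" if "is_partition \<sigma>" for \<sigma>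
        using D(5)[OF c that, of k] D(5)[OF d that, of k] raise_part_add[of 1 e "d (Suc k)" \<sigma>]
        by (simp add: e_def eq)
    qed
    then show ?case using D(1)[OF c] D(1)[OF d] by (cases "is_partition \<rho>") (auto simp: e_def)
  qed
qed

text \<open>
  For \<open>a\<close> as in the next lemma this is the inverse image of \<open>a\<close> under \<open>ones_transform\<close>, described
  without alternating sums:
  where there is no part \<open>1\<close> the transform is the identity, and elsewhere the first recurrence
  prescribes the value.
\<close>
fun family_from :: "(nat \<Rightarrow> nat multiset \<Rightarrow> rat) \<Rightarrow> nat \<Rightarrow> nat multiset \<Rightarrow> rat" where
  "family_from a 0 \<rho> = (if \<rho> = {#} then 1 else 0)"
| "family_from a (Suc k) \<rho> =
     (if \<not> is_partition \<rho> then 0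
      else if 1 \<in># \<rho> then raise_part 1 (family_from a k) (\<rho> - {#1#}) else a (Suc k) \<rho>)"

text \<open>
  The last two hypotheses are the recurrences before binomial inversion. The first recurrence holds by
  construction and gives \<open>T c\<^sub>k = a\<^sub>k\<close> through Pascal's rule; the second one may be checked after applying
  the injective map \<open>T\<close>, where it becomes the hypothesis on \<open>a\<close>.
\<close>
lemma recurrence_family_exists:
  assumes zero: "\<And>\<mu>. is_partition \<mu> \<Longrightarrow> a 0 \<mu> = of_bool (reduced \<mu> = {#})"
    and empty: "\<And>k. a (Suc k) {#} = 0"
    and add: "\<And>k \<mu>. is_partition \<mu> \<Longrightarrow> a (Suc k) (add_mset 1 \<mu>) = a (Suc k) \<mu> + raise_part 1 (a k) \<mu>"
    and raise: "\<And>k \<mu>. is_partition \<mu> \<Longrightarrow> raise_part 1 (a (Suc k)) \<mu> = split_part (a k) \<mu> + join_parts (a k) \<mu>"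
  shows "\<exists>c. recurrence_family c \<and> (\<forall>k \<mu>. is_partition \<mu> \<longrightarrow> ones_transform (c k) \<mu> = a k \<mu>)"
proof -
  define c where "c = family_from a"
  have add_c: "add_part 1 (c (Suc k)) \<rho> = raise_part 1 (c k) \<rho>" if "is_partition \<rho>" for k \<rho>
    using that by (simp add: c_def add_part_def)
  have Tc: "ones_transform (c k) \<mu> = a k \<mu>" if "is_partition \<mu>" for k \<mu>
    using that
  proof (induction k arbitrary: \<mu>)
    case 0
    have "ones_transform (c 0) \<mu> = (\<Sum>j\<le>count \<mu> 1. if j = 0 then of_bool (reduced \<mu> = {#}) else 0)"
      unfolding ones_transform_def c_def by (intro sum.cong) auto
    also have "\<dots> = a 0 \<mu>" using zero[OF 0] by simp
    finally show ?case .
  next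
    case (Suc k)
    from \<open>is_partition \<mu>\<close> show ?case
    proof (induction \<mu> rule: ones_induct)
      case (no_ones \<mu>)
      moreover from this have "1 \<notin># \<mu>" by (simp only: not_in_iff)
      ultimately show ?case by (simp add: ones_transform_no_ones c_def)
    next
      case (add_one \<mu>)
      then have \<mu>: "is_partition \<mu>" by simp
      have "ones_transform (add_part 1 (c (Suc k))) \<mu> = ones_transform (raise_part 1 (c k)) \<mu>"
      proof (intro ones_transform_cong add_c)
        fix \<rho> assume "reduced \<rho> = reduced \<mu>"
        then have "0 \<in># reduced \<rho> \<longleftrightarrow> 0 \<in># reduced \<mu>" by simp
        then show "is_partition \<rho>" using \<mu> by (simp add: is_partition_def reduced_def)
      qed
      also have "\<dots> = raise_part 1 (ones_transform (c k)) \<mu>"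
        by (intro ones_transform_raise_part) simp
      also have "\<dots> = raise_part 1 (a k) \<mu>"
        using Suc.IH \<mu> by (intro raise_part_cong)
      finally show ?case
        using add_one.IH[OF \<mu>] add[OF \<mu>] by (simp only: ones_transform_add_one)
    qed
  qed
  have raise_c: "raise_part 1 (c (Suc k)) \<rho> = twisted_split_part (c k) \<rho> + join_parts (c k) \<rho>"
    if "is_partition \<rho>" for k \<rho>
    using _ that
  proof (rule ones_transform_inj)
    fix \<mu> assume \<mu>: "is_partition \<mu>"
    have "ones_transform (raise_part 1 (c (Suc k))) \<mu> = raise_part 1 (ones_transform (c (Suc k))) \<mu>"
      by (intro ones_transform_raise_part) simp
    also have "\<dots> = raise_part 1 (a (Suc k)) \<mu>"
      using Tc \<mu> by (intro raise_part_cong)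
    also have "\<dots> = split_part (a k) \<mu> + join_parts (a k) \<mu>"
      by (rule raise[OF \<mu>])
    also have "split_part (a k) \<mu> = split_part (ones_transform (c k)) \<mu>"
      using Tc \<mu> by (intro split_part_cong) auto
    also have "join_parts (a k) \<mu> = join_parts (ones_transform (c k)) \<mu>"
      using Tc \<mu> by (intro join_parts_cong) auto
    finally show "ones_transform (raise_part 1 (c (Suc k))) \<mu> =
        ones_transform (\<lambda>\<rho>. twisted_split_part (c k) \<rho> + join_parts (c k) \<rho>) \<mu>"
      by (simp add: ones_transform_add ones_transform_split_part ones_transform_join_parts)
  qed
  have "c k \<rho> = 0" if "\<not> is_partition \<rho>" for k \<rho>
    using that by (cases k) (auto simp: c_def)
  moreover have "c (Suc k) {#} = 0" for k by (simp add: c_def empty)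
  moreover have "c 0 \<rho> = (if \<rho> = {#} then 1 else 0)" for \<rho> by (simp add: c_def)
  ultimately have "recurrence_family c"
    unfolding recurrence_family_iff using add_c raise_c by blast
  then show ?thesis using Tc by blast
qed

section \<open>Cycle types of products with transpositions\<close>

text \<open>
  Orbits of a product with a transposition are found by writing down an enumeration \<open>g\<close> of the new cycle.
\<close>
lemma orbit_eq_image:
  assumes "n > 0" "\<And>t. Suc t < n \<Longrightarrow> v \<langle>$\<rangle> (g t) = g (Suc t)" "v \<langle>$\<rangle> (g (n - 1)) = g 0"
  shows "orbit v (g 0) = g ` {..<n}"
proof
  have "(v ^ t) \<langle>$\<rangle> (g 0) \<in> g ` {..<n}" for t
  proof (induction t)
    case (Suc t)
    then obtain s where s: "s < n" "(v ^ t) \<langle>$\<rangle> (g 0) = g s" by auto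
    then have "(v ^ Suc t) \<langle>$\<rangle> (g 0) = v \<langle>$\<rangle> (g s)" by (simp add: apply_times)
    also have "\<dots> \<in> g ` {..<n}"
      using s assms by (cases "Suc s < n") (auto simp: not_less less_Suc_eq_le dest: le_antisym)
    finally show ?case .
  qed (use assms in auto)
  then show "orbit v (g 0) \<subseteq> g ` {..<n}" by (auto simp: orbit_def)
  have "(v ^ t) \<langle>$\<rangle> (g 0) = g t" if "t < n" for t
    using that by (induction t) (use assms in \<open>auto simp: apply_times\<close>)
  then show "g ` {..<n} \<subseteq> orbit v (g 0)" by (auto intro: in_orbitI)
qed

lemma shift_image: "(\<lambda>t. g (m + t)) ` {..<k} = g ` {m..<m + k :: nat}"
proof -
  have "{m..<m + k} = (+) m ` {..<k}"
    by (simp add: lessThan_atLeast0 add.commute)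
  then show ?thesis by (simp only: image_image)
qed

lemma orbit_cong:
  assumes "\<And>y. y \<in> orbit w x \<Longrightarrow> v \<langle>$\<rangle> y = w \<langle>$\<rangle> y"
  shows "orbit v x = orbit w x"
proof -
  have "(v ^ t) \<langle>$\<rangle> x = (w ^ t) \<langle>$\<rangle> x" for t
    by (induction t) (use assms in \<open>auto simp: apply_times\<close>)
  then show ?thesis by (simp add: orbit_def)
qed

lemma apply_times_swap:
  "(w * \<langle>a \<leftrightarrow> b\<rangle>) \<langle>$\<rangle> a = w \<langle>$\<rangle> b"
  "(w * \<langle>a \<leftrightarrow> b\<rangle>) \<langle>$\<rangle> b = w \<langle>$\<rangle> a"
  "x \<noteq> a \<Longrightarrow> x \<noteq> b \<Longrightarrow> (w * \<langle>a \<leftrightarrow> b\<rangle>) \<langle>$\<rangle> x = w \<langle>$\<rangle> x"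
  by (simp_all add: apply_times)

lemma apply_power_neq:
  assumes "s < t" "t < s + order w a"
  shows "(w ^ t) \<langle>$\<rangle> a \<noteq> (w ^ s) \<langle>$\<rangle> a"
proof
  assume "(w ^ t) \<langle>$\<rangle> a = (w ^ s) \<langle>$\<rangle> a"
  then have "t mod order w a = s mod order w a" by (simp add: apply_power_eq_iff)
  then have "order w a dvd t - s" using assms(1) by (simp add: mod_eq_dvd_iff_nat)
  then show False using assms by (auto dest!: dvd_imp_le)
qed

lemma orbit_image_Suc: "orbit w a = (\<lambda>t. (w ^ Suc t) \<langle>$\<rangle> a) ` {..<order w a}"
  using orbit_unfold_image[of w "w \<langle>$\<rangle> a"] by (simp add: apply_sequence power_Suc2 del: power_Suc)

text \<open>
  The product sends \<open>b\<close> to \<open>w a\<close> and \<open>a\<close> to \<open>w b\<close>, so the cycle \<open>w a, w\<^sup>2 a, \<dots>, w\<^sup>p a = a\<close> is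
  closed up early at \<open>b = w\<^sup>i a\<close>, and the remaining points \<open>w\<^bsup>i+1\<^esup> a, \<dots>, w\<^sup>p a\<close> form a second cycle.
\<close>
lemma orbit_split:
  assumes i: "0 < i" "i < order w a" and b: "b = (w ^ i) \<langle>$\<rangle> a"
  defines "v \<equiv> w * \<langle>a \<leftrightarrow> b\<rangle>"
  shows "order v b = i" "order v a = order w a - i"
    "orbit v a \<inter> orbit v b = {}" "orbit v a \<union> orbit v b = orbit w a"
proof -
  define p where "p = order w a"
  define g where "g t = (w ^ Suc t) \<langle>$\<rangle> a" for t
  have step: "w \<langle>$\<rangle> (g t) = g (Suc t)" for t by (simp add: g_def apply_times)
  have gb: "g (i - 1) = b" using i b by (simp add: g_def flip: power_Suc)
  have ga: "g (p - 1) = a" using i by (simp add: g_def p_def flip: power_Suc)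
  have inj: "inj_on g {..<p}"
  proof (rule inj_onI)
    fix s t assume "s \<in> {..<p}" "t \<in> {..<p}" "g s = g t"
    then show "s = t"
      using apply_power_neq[of "Suc s" "Suc t" w a] apply_power_neq[of "Suc t" "Suc s" w a]
      by (cases s t rule: linorder_cases) (auto simp: g_def p_def)
  qed
  have lt: "p - 1 < p" "i - 1 < p" using i by (auto simp: p_def)
  have neq: "g t \<noteq> a" "g t \<noteq> b" if "t < p" "t \<noteq> p - 1" "t \<noteq> i - 1" for t
    using inj_onD[OF inj, of t "p - 1"] inj_onD[OF inj, of t "i - 1"] that lt unfolding ga gb by auto
  have 1: "orbit v (g 0) = g ` {..<i}"
  proof (rule orbit_eq_image)
    show "v \<langle>$\<rangle> (g t) = g (Suc t)" if "Suc t < i" for t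
      using that i neq[of t] unfolding v_def step[symmetric] by (intro apply_times_swap) (auto simp: p_def)
    show "v \<langle>$\<rangle> (g (i - 1)) = g 0"
      unfolding gb unfolding v_def apply_times_swap by (simp add: g_def)
  qed (rule i)
  have 2: "orbit v (g (i + 0)) = (\<lambda>t. g (i + t)) ` {..<p - i}"
  proof (rule orbit_eq_image[where g="\<lambda>t. g (i + t)"])
    show "p - i > 0" using i by (simp add: p_def)
    show "v \<langle>$\<rangle> (g (i + t)) = g (i + Suc t)" if "Suc t < p - i" for t
      using that i neq[of "i + t"] unfolding v_def add_Suc_right step[symmetric]
      by (intro apply_times_swap) auto
    have e: "i + (p - i - 1) = p - 1" using i by (simp add: p_def)
    show "v \<langle>$\<rangle> (g (i + (p - i - 1))) = g (i + 0)"
      unfolding e ga unfolding v_def apply_times_swap by (simp add: g_def b apply_times)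
  qed
  have "b \<in> orbit v (g 0)" unfolding 1 using gb i by (auto intro!: image_eqI[of _ _ "i - 1"])
  then have ob: "orbit v b = g ` {..<i}" using 1 orbit_equiv by metis
  have "(\<lambda>t. g (i + t)) ` {..<p - i} = g ` {i..<p}"
    using i by (simp add: shift_image p_def)
  moreover have "a \<in> g ` {i..<p}" using ga i by (auto simp: p_def intro!: image_eqI[of _ _ "p - 1"])
  ultimately have oa: "orbit v a = g ` {i..<p}" using 2 orbit_equiv by (metis add_0_right)
  have sub: "{i..<p} \<subseteq> {..<p}" "{..<i} \<subseteq> {..<p}" using i by (auto simp: p_def)
  have "card (g ` {..<i}) = i" by (simp add: card_image[OF inj_on_subset[OF inj sub(2)]])
  then show "order v b = i" using ob by (metis card_orbit_eq)
  have "card (g ` {i..<p}) = p - i" by (simp add: card_image[OF inj_on_subset[OF inj sub(1)]])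
  then show "order v a = order w a - i" using oa by (metis card_orbit_eq p_def)
  have "{i..<p} \<inter> {..<i} = {}" by auto
  then show "orbit v a \<inter> orbit v b = {}" unfolding oa ob inj_on_image_Int[OF inj sub, symmetric]
    by simp
  have "{..<p} = {i..<p} \<union> {..<i}" using i by (auto simp: p_def)
  then show "orbit v a \<union> orbit v b = orbit w a" unfolding oa ob orbit_image_Suc[of w a]
    by (simp add: g_def[abs_def] image_Un p_def del: power_Suc)
qed

text \<open>The cycle through \<open>w b, w\<^sup>2 b, \<dots>, b\<close> now continues with \<open>w a, w\<^sup>2 a, \<dots>, a\<close>.\<close>
lemma orbit_join:
  assumes ab: "orbit w a \<noteq> orbit w b"
  defines "v \<equiv> w * \<langle>a \<leftrightarrow> b\<rangle>"
  shows "orbit v a = orbit w a \<union> orbit w b" "orbit v b = orbit w a \<union> orbit w b"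
proof -
  define p r where "p = order w a" and "r = order w b"
  define g where "g t = (if t < r then (w ^ Suc t) \<langle>$\<rangle> b else (w ^ Suc (t - r)) \<langle>$\<rangle> a)" for t
  have pr: "p > 0" "r > 0" by (simp_all add: p_def r_def)
  have notin: "(w ^ t) \<langle>$\<rangle> b \<noteq> a" "(w ^ t) \<langle>$\<rangle> a \<noteq> b" for t
    using ab orbit_apply_power[of w t a] orbit_apply_power[of w t b] by auto
  have self: "(w ^ t) \<langle>$\<rangle> x \<noteq> x" if "0 < t" "t < order w x" for t x
    using apply_power_neq[of 0 t w x] that by simp
  have "orbit v (g 0) = g ` {..<r + p}"
  proof (rule orbit_eq_image)
    show "r + p > 0" using pr by simp
    show "v \<langle>$\<rangle> (g t) = g (Suc t)" if t: "Suc t < r + p" for t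
    proof (cases "Suc t" r rule: linorder_cases)
      case less
      then have "v \<langle>$\<rangle> (g t) = w \<langle>$\<rangle> (g t)" unfolding v_def
        using notin self[of "Suc t" b] by (intro apply_times_swap) (auto simp: g_def r_def simp del: power_Suc)
      then show ?thesis using less by (simp add: g_def apply_times)
    next
      case equal
      then have "g t = b" by (auto simp: g_def r_def simp del: power_Suc)
      then show ?thesis using equal unfolding v_def by (simp add: apply_times_swap) (simp add: g_def)
    next
      case greater
      then have "v \<langle>$\<rangle> (g t) = w \<langle>$\<rangle> (g t)" unfolding v_def
        using notin self[of "Suc (t - r)" a] t
        by (intro apply_times_swap) (auto simp: g_def p_def simp del: power_Suc)
      then show ?thesis using greater by (simp add: g_def apply_times Suc_diff_le)
    qed
    have last: "\<not> r + p - 1 < r" "Suc (r + p - 1 - r) = p" using pr by auto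
    have "g (r + p - 1) = (w ^ p) \<langle>$\<rangle> a" unfolding g_def last(2) using last(1) by simp
    then have "g (r + p - 1) = a" by (simp add: p_def)
    then show "v \<langle>$\<rangle> (g (r + p - 1)) = g 0"
      using pr unfolding v_def by (simp only: apply_times_swap) (simp add: g_def)
  qed
  also have "{..<r + p} = {..<r} \<union> {r..<r + p}" by auto
  also have "g ` \<dots> = orbit w a \<union> orbit w b"
    unfolding image_Un shift_image[symmetric] orbit_image_Suc[of w a] orbit_image_Suc[of w b]
    by (auto simp: g_def p_def r_def simp del: power_Suc)
  finally have *: "orbit v (g 0) = orbit w a \<union> orbit w b" .
  then show "orbit v a = orbit w a \<union> orbit w b" "orbit v b = orbit w a \<union> orbit w b"
    using orbit_equiv[of a v "g 0"] orbit_equiv[of b v "g 0"] by auto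
qed

lemma in_orbit_iff: "x \<in> orbit w c \<longleftrightarrow> orbit w x = orbit w c"
  by (metis in_orbit_self orbit_equiv)

lemma orbit_times_swap_other:
  assumes "x \<notin> orbit w a \<union> orbit w b"
  shows "orbit (w * \<langle>a \<leftrightarrow> b\<rangle>) x = orbit w x"
proof (rule orbit_cong)
  fix y assume "y \<in> orbit w x"
  then have "orbit w y = orbit w x" by (rule orbit_equiv)
  then have "y \<noteq> a" "y \<noteq> b" using assms unfolding Un_iff in_orbit_iff by auto
  then show "(w * \<langle>a \<leftrightarrow> b\<rangle>) \<langle>$\<rangle> y = w \<langle>$\<rangle> y" by (rule apply_times_swap)
qed

lemma orbit_notin_image:
  assumes "orbit w c \<subseteq> B"
  shows "orbit w c \<notin> orbit w ` (A - B)"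
proof
  assume "orbit w c \<in> orbit w ` (A - B)"
  then obtain x where "orbit w c = orbit w x" "x \<notin> B" by (elim imageE DiffE)
  then show False using assms in_orbit_self[of x w] by blast
qed

text \<open>
  Whether \<open>a\<close> and \<open>b\<close> lie on the same cycle of \<open>w\<close> or not, the union of their cycles is the same for
  \<open>w\<close> and for \<open>w * \<langle>a \<leftrightarrow> b\<rangle>\<close>. So this decomposition has the same second summand for both.
\<close>
lemma cycle_type_two_points:
  assumes "a \<in> {1..n}" "b \<in> {1..n}"
  shows "cycle_type n w =
    (if orbit w a = orbit w b then {#order w a#} else {#order w a, order w b#}) +
    image_mset card (mset_set (orbit w ` ({1..n} - (orbit w a \<union> orbit w b))))"
proof -
  let ?R = "orbit w ` ({1..n} - (orbit w a \<union> orbit w b))"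
  have "orbit w ` {1..n} = {orbit w a, orbit w b} \<union> ?R"
    using assms by (auto simp: in_orbit_iff)
  moreover have "orbit w a \<notin> ?R" "orbit w b \<notin> ?R"
    by (intro orbit_notin_image Un_upper1 Un_upper2)+
  ultimately show ?thesis
    unfolding cycle_type_def by (cases "orbit w a = orbit w b") (simp_all add: order_def del: card_orbit_eq)
qed

lemma cycle_type_split:
  assumes "a \<in> {1..n}" "b \<in> {1..n}" "0 < i" "i < order w a" "b = (w ^ i) \<langle>$\<rangle> a"
  shows "cycle_type n (w * \<langle>a \<leftrightarrow> b\<rangle>) =
    add_mset i (add_mset (order w a - i) (cycle_type n w - {#order w a#}))"
proof -
  note s = orbit_split[OF assms(3-5)]
  have ob: "orbit w b = orbit w a" using assms(5) by simp
  have ne: "orbit (w * \<langle>a \<leftrightarrow> b\<rangle>) a \<noteq> orbit (w * \<langle>a \<leftrightarrow> b\<rangle>) b"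
    using s(3) by auto
  have "orbit (w * \<langle>a \<leftrightarrow> b\<rangle>) ` ({1..n} - orbit w a) = orbit w ` ({1..n} - orbit w a)"
    by (intro image_cong refl orbit_times_swap_other) (auto simp: ob)
  then show ?thesis
    using cycle_type_two_points[OF assms(1,2), of w] cycle_type_two_points[OF assms(1,2), of "w * \<langle>a \<leftrightarrow> b\<rangle>"] s ob ne
    by simp
qed

lemma cycle_type_join:
  assumes "a \<in> {1..n}" "b \<in> {1..n}" "orbit w a \<noteq> orbit w b"
  shows "cycle_type n (w * \<langle>a \<leftrightarrow> b\<rangle>) =
      add_mset (order w a + order w b) (cycle_type n w - {#order w a, order w b#})"
proof -
  note s = orbit_join[OF assms(3)]
  have "card (orbit w a \<union> orbit w b) = order w a + order w b"
    using orbit_disjoint[OF assms(3)] by (simp add: card_Un_disjoint)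
  then have o: "order (w * \<langle>a \<leftrightarrow> b\<rangle>) a = order w a + order w b" using s(1) by (metis card_orbit_eq)
  have "orbit (w * \<langle>a \<leftrightarrow> b\<rangle>) ` ({1..n} - (orbit w a \<union> orbit w b)) = orbit w ` ({1..n} - (orbit w a \<union> orbit w b))"
    by (intro image_cong refl orbit_times_swap_other) auto
  then show ?thesis
    using cycle_type_two_points[OF assms(1,2), of w] cycle_type_two_points[OF assms(1,2), of "w * \<langle>a \<leftrightarrow> b\<rangle>"] s o assms(3)
    by simp
qed

lemma order_in_cycle_type: "a \<in> {1..n} \<Longrightarrow> order w a \<in># cycle_type n w"
  unfolding card_orbit_eq[symmetric] by (auto simp: cycle_type_def simp del: card_orbit_eq)

lemma in_cycle_typeE:
  assumes "p \<in># cycle_type n w"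
  obtains a where "a \<in> {1..n}" "order w a = p"
  using assms by (auto simp: cycle_type_def)

lemma orbit_subset:
  assumes "w \<in> sym_group n" "a \<in> {1..n}"
  shows "orbit w a \<subseteq> {1..n}"
  using assms orbit_subset_eq_affected[of a w]
  by (cases "a \<in> affected w") (auto simp: sym_group_def not_in_affected_iff_orbit_eq_singleton)

lemma Union_orbits:
  assumes "w \<in> sym_group n"
  shows "\<Union> (orbit w ` {1..n}) = {1..n}"
proof
  show "\<Union> (orbit w ` {1..n}) \<subseteq> {1..n}" by (intro UN_least orbit_subset[OF assms])
  show "{1..n} \<subseteq> \<Union> (orbit w ` {1..n})" using in_orbit_self by (intro subsetI UN_I)
qed

lemma sum_over_orbits:
  assumes "w \<in> sym_group n" "\<O> \<subseteq> orbit w ` {1..n}"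
  shows "(\<Sum>j\<in>\<Union>\<O>. F (order w j)) = (\<Sum>r\<in>#image_mset card (mset_set \<O>). of_nat r * (F r :: 'a :: semiring_1))"
proof -
  have "finite \<O>" using assms(2) finite_subset by blast
  have "(\<Sum>j\<in>\<Union>\<O>. F (order w j)) = (\<Sum>C\<in>\<O>. \<Sum>j\<in>C. F (order w j))"
  proof -
    have "\<forall>A\<in>\<O>. \<forall>B\<in>\<O>. A \<noteq> B \<longrightarrow> A \<inter> B = {}"
    proof (intro ballI impI)
      fix A B assume "A \<in> \<O>" "B \<in> \<O>" "A \<noteq> B"
      then obtain a b where "A = orbit w a" "B = orbit w b" using assms(2) by blast
      then show "A \<inter> B = {}" using orbit_disjoint \<open>A \<noteq> B\<close> by metis
    qed
    moreover have "\<forall>A\<in>\<O>. finite A" using assms(2) by auto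
    ultimately show ?thesis by (subst sum.Union_disjoint) auto
  qed
  also have "\<dots> = (\<Sum>C\<in>\<O>. of_nat (card C) * F (card C))"
  proof (rule sum.cong)
    fix C assume "C \<in> \<O>"
    then obtain a where "C = orbit w a" using assms(2) by auto
    then have "order w j = card C" if "j \<in> C" for j
      using that orbit_equiv by (metis card_orbit_eq)
    then show "(\<Sum>j\<in>C. F (order w j)) = of_nat (card C) * F (card C)" by simp
  qed simp
  finally show ?thesis by (simp add: sum_unfold_sum_mset image_mset.compositionality comp_def)
qed

lemma weight_cycle_type:
  assumes "w \<in> sym_group n"
  shows "weight (cycle_type n w) = n"
  using sum_over_orbits[OF assms order_refl, of "\<lambda>_. 1::nat"] Union_orbits[OF assms]
  by (simp add: cycle_type_def)

lemma is_partition_cycle_type: "is_partition (cycle_type n w)"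
  unfolding is_partition_def
proof
  assume "0 \<in># cycle_type n w"
  then obtain a where "order w a = 0" by (rule in_cycle_typeE)
  then show False using order_greater_zero[of w a] by simp
qed

text \<open>
  The points \<open>b = w\<^sup>i a\<close> on the cycle of \<open>a\<close> split it, one for each \<open>0 < i < p\<close>; the points on another
  cycle of length \<open>r\<close>, which are \<open>r\<close> in number, join it to the cycle of \<open>a\<close>.
\<close>
lemma sum_cycle_type_times_swap:
  fixes f :: "nat multiset \<Rightarrow> 'a :: semiring_1"
  assumes w: "w \<in> sym_group n" and a: "a \<in> {1..n}"
  defines "\<mu> \<equiv> cycle_type n w" and "p \<equiv> order w a"
  shows "(\<Sum>b\<in>{1..n} - {a}. f (cycle_type n (w * \<langle>a \<leftrightarrow> b\<rangle>))) =
     (\<Sum>i\<in>{1..<p}. f (add_mset i (add_mset (p - i) (\<mu> - {#p#})))) +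
     (\<Sum>r\<in>#\<mu> - {#p#}. of_nat r * f (add_mset (p + r) (\<mu> - {#p, r#})))"
proof -
  let ?F = "\<lambda>b. f (cycle_type n (w * \<langle>a \<leftrightarrow> b\<rangle>))"
  let ?\<O> = "orbit w ` {1..n} - {orbit w a}"
  have eq: "{1..n} - {a} = (orbit w a - {a}) \<union> \<Union>?\<O>"
  proof -
    have "a \<notin> \<Union>?\<O>" by (auto simp: in_orbit_iff)
    moreover have "{1..n} = orbit w a \<union> \<Union>?\<O>" using Union_orbits[OF w] a by auto
    ultimately show ?thesis by blast
  qed
  have disj: "(orbit w a - {a}) \<inter> \<Union>?\<O> = {}" by (auto simp: in_orbit_iff)
  have "(\<Sum>b\<in>{1..n} - {a}. ?F b) = (\<Sum>b\<in>orbit w a - {a}. ?F b) + (\<Sum>b\<in>\<Union>?\<O>. ?F b)"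
    unfolding eq by (rule sum.union_disjoint[OF _ _ disj]) auto
  also have "(\<Sum>b\<in>orbit w a - {a}. ?F b) =
      (\<Sum>i\<in>{1..<p}. f (add_mset i (add_mset (p - i) (\<mu> - {#p#}))))"
  proof -
    have img: "orbit w a - {a} = (\<lambda>i. (w ^ i) \<langle>$\<rangle> a) ` {1..<p}"
    proof -
      have "{..<p} = insert 0 {1..<p}" by (auto simp: p_def)
      then have oa: "orbit w a = insert a ((\<lambda>i. (w ^ i) \<langle>$\<rangle> a) ` {1..<p})"
        unfolding orbit_unfold_image[of w a] p_def[symmetric] by simp
      have ne: "(w ^ i) \<langle>$\<rangle> a \<noteq> a" if "i \<in> {1..<p}" for i
        using apply_power_neq[of 0 i w a] that by (simp add: p_def)
      have "a \<notin> (\<lambda>i. (w ^ i) \<langle>$\<rangle> a) ` {1..<p}"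
      proof
        assume "a \<in> (\<lambda>i. (w ^ i) \<langle>$\<rangle> a) ` {1..<p}"
        then obtain i where i: "i \<in> {1..<p}" "a = (w ^ i) \<langle>$\<rangle> a" by (rule imageE)
        show False by (rule notE[OF ne[OF i(1)] i(2)[symmetric]])
      qed
      then show ?thesis unfolding oa by blast
    qed
    have inj: "inj_on (\<lambda>i. (w ^ i) \<langle>$\<rangle> a) {1..<p}"
      using inj_on_apply_range[of w a] by (rule inj_on_subset) (auto simp: p_def)
    show ?thesis unfolding img sum.reindex[OF inj]
    proof (intro sum.cong refl)
      fix i assume i: "i \<in> {1..<p}"
      have "(w ^ i) \<langle>$\<rangle> a \<in> {1..n}"
        by (rule subsetD[OF orbit_subset[OF w a] apply_power_self_in_orbit])
      then show "(?F \<circ> (\<lambda>i. (w ^ i) \<langle>$\<rangle> a)) i = f (add_mset i (add_mset (p - i) (\<mu> - {#p#})))"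
        using cycle_type_split[OF a _ _ _ refl, where w=w and i=i] i by (simp add: \<mu>_def p_def)
    qed
  qed
  also have "(\<Sum>b\<in>\<Union>?\<O>. ?F b) = (\<Sum>b\<in>\<Union>?\<O>. f (add_mset (p + order w b) (\<mu> - {#p, order w b#})))"
  proof (rule sum.cong)
    fix b assume b: "b \<in> \<Union>?\<O>"
    then have "b \<in> {1..n}" using Union_orbits[OF w] by auto
    moreover have "orbit w a \<noteq> orbit w b" using b orbit_equiv by fastforce
    ultimately show "?F b = f (add_mset (p + order w b) (\<mu> - {#p, order w b#}))"
      using a by (simp add: cycle_type_join \<mu>_def p_def)
  qed simp
  also have "\<dots> = (\<Sum>r\<in>#image_mset card (mset_set ?\<O>). of_nat r * f (add_mset (p + r) (\<mu> - {#p, r#})))"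
    using w by (intro sum_over_orbits) auto
  also have "image_mset card (mset_set ?\<O>) = \<mu> - {#p#}"
    using a by (simp add: \<mu>_def p_def cycle_type_def mset_set_Diff image_mset_Diff)
  finally show ?thesis .
qed

lemma orbit_conjugate_swap:
  "orbit (\<langle>a \<leftrightarrow> b\<rangle> * w * \<langle>a \<leftrightarrow> b\<rangle>) x = (\<lambda>y. \<langle>a \<leftrightarrow> b\<rangle> \<langle>$\<rangle> y) ` orbit w (\<langle>a \<leftrightarrow> b\<rangle> \<langle>$\<rangle> x)"
proof -
  let ?s = "\<langle>a \<leftrightarrow> b\<rangle>"
  have "(?s * w * ?s) ^ t = ?s * w ^ t * ?s" for t
  proof (induction t)
    case (Suc t)
    have "(?s * w * ?s) ^ Suc t = ?s * w * (?s * ?s) * w ^ t * ?s"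
      unfolding power_Suc Suc by (simp only: mult.assoc)
    then show ?case by (simp add: mult.assoc)
  qed simp
  then have "((?s * w * ?s) ^ t) \<langle>$\<rangle> x = ?s \<langle>$\<rangle> ((w ^ t) \<langle>$\<rangle> (?s \<langle>$\<rangle> x))" for t
    by (simp add: apply_times)
  then show ?thesis by (simp add: orbit_def image_image)
qed

lemma apply_in_sym_group:
  assumes "w \<in> sym_group n"
  shows "apply w ` {1..n} = {1..n}"
proof (rule endo_inj_surj)
  have "w \<langle>$\<rangle> x \<in> {1..n}" if "x \<in> {1..n}" for x
    by (rule subsetD[OF orbit_subset[OF assms that] apply_self_in_orbit])
  then show "apply w ` {1..n} \<subseteq> {1..n}" by blast
  show "inj_on (apply w) {1..n}" by (auto simp: inj_on_def apply_inj)
qed simp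

lemma swap_in_sym_group: "a \<in> {1..n} \<Longrightarrow> b \<in> {1..n} \<Longrightarrow> \<langle>a \<leftrightarrow> b\<rangle> \<in> sym_group n"
  by (cases "a = b") (auto simp: sym_group_def affected_swap)

lemma times_in_sym_group: "v \<in> sym_group n \<Longrightarrow> w \<in> sym_group n \<Longrightarrow> v * w \<in> sym_group n"
  unfolding sym_group_def using affected_times[of v w] by blast

lemma cycle_type_conjugate_swap:
  assumes "a \<in> {1..n}" "b \<in> {1..n}"
  shows "cycle_type n (\<langle>a \<leftrightarrow> b\<rangle> * w * \<langle>a \<leftrightarrow> b\<rangle>) = cycle_type n w"
proof -
  let ?s = "\<langle>a \<leftrightarrow> b\<rangle>"
  have inj: "inj (apply ?s)" by (simp add: bij_is_inj)
  have "orbit (?s * w * ?s) ` {1..n} = image (apply ?s) ` orbit w ` apply ?s ` {1..n}"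
    by (simp add: orbit_conjugate_swap image_image)
  also have "apply ?s ` {1..n} = {1..n}"
    by (rule apply_in_sym_group[OF swap_in_sym_group[OF assms]])
  finally have "cycle_type n (?s * w * ?s) = image_mset card (mset_set (image (apply ?s) ` orbit w ` {1..n}))"
    by (simp add: cycle_type_def)
  also have "mset_set (image (apply ?s) ` orbit w ` {1..n}) = image_mset (image (apply ?s)) (mset_set (orbit w ` {1..n}))"
    by (rule image_mset_mset_set[symmetric]) (simp add: inj_on_def inj_image_eq_iff[OF inj])
  also have "image_mset card \<dots> = image_mset card (mset_set (orbit w ` {1..n}))"
    by (simp add: image_mset.compositionality comp_def card_image[OF inj_on_subset[OF inj subset_UNIV]] del: card_orbit_eq)
  finally show ?thesis by (simp add: cycle_type_def)
qed

lemma order_conjugate_swap: "order (\<langle>a \<leftrightarrow> b\<rangle> * w * \<langle>a \<leftrightarrow> b\<rangle>) a = order w b"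
  unfolding order_def comp_def orbit_conjugate_swap
  by (subst card_image) (auto simp: inj_on_def apply_inj)

lemma sym_group_Suc: "w \<in> sym_group n \<Longrightarrow> w \<in> sym_group (Suc n)"
  by (auto simp: sym_group_def)

lemma sym_group_Suc_fixed:
  assumes "w \<in> sym_group (Suc n)" "order w (Suc n) = 1"
  shows "w \<in> sym_group n"
proof -
  have "Suc n \<notin> affected w" using assms(2) by (simp add: order_eq_one_iff)
  moreover have "{1..Suc n} = insert (Suc n) {1..n}" by auto
  ultimately show ?thesis using assms(1) by (simp add: sym_group_def subset_insert)
qed

lemma order_Suc: "w \<in> sym_group n \<Longrightarrow> order w (Suc n) = 1"
  by (auto simp: sym_group_def order_eq_one_iff)

lemma cycle_type_Suc:
  assumes "w \<in> sym_group n"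
  shows "cycle_type (Suc n) w = add_mset 1 (cycle_type n w)"
proof -
  have "Suc n \<notin> affected w" using assms by (auto simp: sym_group_def)
  then have o: "orbit w (Suc n) = {Suc n}" by (simp add: not_in_affected_iff_orbit_eq_singleton)
  have "{Suc n} \<notin> orbit w ` {1..n}"
  proof
    assume "{Suc n} \<in> orbit w ` {1..n}"
    then obtain x where x: "{Suc n} = orbit w x" "x \<in> {1..n}" by (rule imageE)
    show False using orbit_subset[OF assms x(2)] unfolding x(1)[symmetric] by simp
  qed
  then show ?thesis using o by (simp add: cycle_type_def atLeastAtMostSuc_conv)
qed

lemma reduced_cycle_type_eq_empty_iff:
  assumes "w \<in> sym_group n"
  shows "reduced (cycle_type n w) = {#} \<longleftrightarrow> w = 1"
proof -
  have "reduced (cycle_type n w) = {#} \<longleftrightarrow> (\<forall>a\<in>{1..n}. order w a = 1)"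
    unfolding reduced_def filter_mset_eq_mempty_iff using order_in_cycle_type in_cycle_typeE by metis
  also have "\<dots> \<longleftrightarrow> affected w = {}"
    using assms by (auto simp: order_eq_one_iff sym_group_def simp del: affected_empty_iff)
  finally show ?thesis by simp
qed

text \<open>A cycle is extended by the new point \<open>n + 1\<close> through joining it with the fixed point \<open>n + 1\<close>.\<close>
lemma cycle_type_surj:
  assumes "is_partition \<mu>"
  obtains w where "w \<in> sym_group (weight \<mu>)" "cycle_type (weight \<mu>) w = \<mu>"
proof -
  have "\<exists>w \<in> sym_group n. cycle_type n w = \<mu>" if "is_partition \<mu>" "weight \<mu> = n" for n \<mu>
    using that
  proof (induction n arbitrary: \<mu>)
    case 0
    then have "\<mu> = {#}" by (cases \<mu>) (auto simp: is_partition_def)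
    then show ?case by (auto intro!: bexI[of _ 1] simp: cycle_type_def sym_group_def)
  next
    case (Suc n)
    then obtain p \<nu> where \<mu>: "\<mu> = add_mset p \<nu>" by (cases \<mu>) auto
    then have p: "p \<noteq> 0" and \<nu>: "is_partition \<nu>" using Suc.prems by (auto simp: is_partition_def)
    show ?case
    proof (cases "p = 1")
      case True
      then have "weight \<nu> = n" using Suc.prems \<mu> by simp
      then obtain w where "w \<in> sym_group n" "cycle_type n w = \<nu>" using Suc.IH \<nu> by blast
      then show ?thesis using True \<mu> by (intro bexI[of _ w]) (auto simp: cycle_type_Suc sym_group_Suc)
    next
      case False
      have "is_partition (add_mset (p - 1) \<nu>)" "weight (add_mset (p - 1) \<nu>) = n"
        using p False \<nu> Suc.prems \<mu> by (auto simp: is_partition_def)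
      then obtain w where w: "w \<in> sym_group n" "cycle_type n w = add_mset (p - 1) \<nu>"
        using Suc.IH by blast
      then obtain b where b: "b \<in> {1..n}" "order w b = p - 1"
        by (metis in_cycle_typeE union_single_eq_member)
      let ?v = "w * \<langle>Suc n \<leftrightarrow> b\<rangle>"
      have "orbit w (Suc n) \<noteq> orbit w b"
        using orbit_subset[OF w(1) b(1)] in_orbit_self[of "Suc n" w] by (metis atLeastAtMost_iff not_less_eq_eq order_refl subsetD)
      then have "cycle_type (Suc n) ?v =
          add_mset (order w (Suc n) + order w b) (cycle_type (Suc n) w - {#order w (Suc n), order w b#})"
        using b by (intro cycle_type_join) auto
      also have "\<dots> = \<mu>" using w b p False by (simp add: order_Suc cycle_type_Suc \<mu>)
      finally have "cycle_type (Suc n) ?v = \<mu>" .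
      moreover have "?v \<in> sym_group (Suc n)"
        using w b by (intro times_in_sym_group swap_in_sym_group sym_group_Suc) auto
      ultimately show ?thesis by blast
    qed
  qed
  then show ?thesis using assms that by blast
qed

section \<open>Complete homogeneous functions of Jucys-Murphy elements are central\<close>

lemma basis_mult: "basis v * basis w = basis (v * w :: 'g :: monoid_mult)"
  by (simp add: basis_def mult_single plus_additive_def)

lemma basis_one: "basis (1 :: 'g :: monoid_mult) = 1"
  by (simp add: basis_def zero_additive_def[symmetric])

lemma lookup_basis: "Poly_Mapping.lookup (basis v) (Additive w) = of_bool (v = w)"
  by (simp add: basis_def lookup_single when_def)

lemma lookup_times_basis:
  fixes x :: "'g perm group_algebra"
  shows "Poly_Mapping.lookup (x * basis p) (Additive w) = Poly_Mapping.lookup x (Additive (w * inverse p))"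
proof -
  have eq: "Additive w = l + Additive p \<longleftrightarrow> l = Additive (w * inverse p)" for l
    by (cases l) (auto simp: plus_additive_def mult.assoc)
  have "(\<Sum>q. (Poly_Mapping.lookup (basis p) q when Additive w = l + q)) = (1 when l = Additive (w * inverse p))" for l
  proof -
    have "(\<Sum>q. (Poly_Mapping.lookup (basis p) q when Additive w = l + q)) =
        (\<Sum>q\<in>{Additive p}. (Poly_Mapping.lookup (basis p) q when Additive w = l + q))"
      by (rule Sum_any.expand_superset) (auto simp: basis_def lookup_single when_def)
    then show ?thesis by (simp add: basis_def eq)
  qed
  then have "Poly_Mapping.lookup (x * basis p) (Additive w) =
      (\<Sum>l. Poly_Mapping.lookup x l * (1 when l = Additive (w * inverse p)))"
    by (simp add: lookup_mult)
  also have "\<dots> = (\<Sum>l\<in>{Additive (w * inverse p)}. Poly_Mapping.lookup x l * (1 when l = Additive (w * inverse p)))"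
    by (rule Sum_any.expand_superset) (auto simp: when_def)
  finally show ?thesis by simp
qed

lemma lookup_basis_times:
  fixes x :: "'g perm group_algebra"
  shows "Poly_Mapping.lookup (basis p * x) (Additive w) = Poly_Mapping.lookup x (Additive (inverse p * w))"
proof -
  let ?f = "\<lambda>l. \<Sum>q. (Poly_Mapping.lookup x q when Additive w = l + q)"
  have eq: "Additive w = Additive p + q \<longleftrightarrow> q = Additive (inverse p * w)" for q
    by (cases q) (auto simp: plus_additive_def mult.assoc[symmetric])
  have "Poly_Mapping.lookup (basis p * x) (Additive w) = (\<Sum>l. Poly_Mapping.lookup (basis p) l * ?f l)"
    by (simp add: lookup_mult)
  also have "\<dots> = (\<Sum>l\<in>{Additive p}. Poly_Mapping.lookup (basis p) l * ?f l)"
    by (rule Sum_any.expand_superset) (auto simp: basis_def lookup_single when_def)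
  also have "\<dots> = ?f (Additive p)" by (simp add: basis_def)
  also have "\<dots> = (\<Sum>q\<in>{Additive (inverse p * w)}. (Poly_Mapping.lookup x q when Additive w = Additive p + q))"
    unfolding eq by (rule Sum_any.expand_superset) (auto simp: when_def)
  finally show ?thesis by (simp add: eq)
qed

lemma complete_homogeneous_0: "complete_homogeneous 0 n x = 1"
proof -
  have "{is. length is = 0 \<and> sorted is \<and> set is \<subseteq> {1..n}} = {[]}" by auto
  then show ?thesis by (simp add: complete_homogeneous_def)
qed

lemma complete_homogeneous_Suc_0: "complete_homogeneous (Suc k) 0 x = 0"
proof -
  have eq: "{is. length is = Suc k \<and> sorted is \<and> set is \<subseteq> {1..0::nat}} = {}" by auto
  show ?thesis unfolding complete_homogeneous_def eq by simp
qed

text \<open>The last index of a nondecreasing sequence is \<open>n + 1\<close>, or all indices are at most \<open>n\<close>.\<close>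
lemma complete_homogeneous_Suc_Suc:
  "complete_homogeneous (Suc k) (Suc n) x =
     complete_homogeneous (Suc k) n x + complete_homogeneous k (Suc n) x * x (Suc n)"
proof -
  define S where "S k n = {is. length is = k \<and> sorted is \<and> set is \<subseteq> {1..n}}" for k n :: nat
  have fin: "finite (S k n)" for k n
    by (rule finite_subset[OF _ finite_lists_length_eq[of "{1..n}" k]]) (auto simp: S_def)
  have "S (Suc k) (Suc n) = S (Suc k) n \<union> (\<lambda>is. is @ [Suc n]) ` S k (Suc n)"
  proof (intro subset_antisym subsetI)
    fix js assume js: "js \<in> S (Suc k) (Suc n)"
    then obtain ys y where y: "js = ys @ [y]" by (cases js rule: rev_cases) (auto simp: S_def)
    show "js \<in> S (Suc k) n \<union> (\<lambda>is. is @ [Suc n]) ` S k (Suc n)"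
    proof (cases "y = Suc n")
      case True
      then show ?thesis using js y by (auto simp: S_def sorted_append)
    next
      case False
      then have "js \<in> S (Suc k) n" using js y by (fastforce simp: S_def sorted_append)
      then show ?thesis by simp
    qed
  next
    fix js assume "js \<in> S (Suc k) n \<union> (\<lambda>is. is @ [Suc n]) ` S k (Suc n)"
    then show "js \<in> S (Suc k) (Suc n)" by (fastforce simp: S_def sorted_append)
  qed
  moreover have "S (Suc k) n \<inter> (\<lambda>is. is @ [Suc n]) ` S k (Suc n) = {}" by (auto simp: S_def)
  ultimately have "(\<Sum>js\<in>S (Suc k) (Suc n). prod_list (map x js)) =
      (\<Sum>js\<in>S (Suc k) n. prod_list (map x js)) +
      (\<Sum>js\<in>(\<lambda>is. is @ [Suc n]) ` S k (Suc n). prod_list (map x js))"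
    using fin by (simp add: sum.union_disjoint)
  also have "(\<Sum>js\<in>(\<lambda>is. is @ [Suc n]) ` S k (Suc n). prod_list (map x js)) =
      (\<Sum>js\<in>S k (Suc n). prod_list (map x js)) * x (Suc n)"
    by (subst sum.reindex) (auto simp: inj_on_def sum_distrib_right)
  finally show ?thesis by (simp add: complete_homogeneous_def S_def)
qed

lemma commute_mult:
  fixes s :: "'a :: semigroup_mult"
  assumes "s * x = x * s" "s * y = y * s"
  shows "s * (x * y) = x * y * s"
  using assms by (metis mult.assoc)

lemma complete_homogeneous_commute:
  assumes "\<And>i. i \<in> {1..n} \<Longrightarrow> s * x i = x i * s"
  shows "s * complete_homogeneous k n x = complete_homogeneous k n x * s"
  using assms
proof (induction n arbitrary: k)
  case 0
  then show ?case by (cases k) (simp_all add: complete_homogeneous_0 complete_homogeneous_Suc_0)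
next
  case (Suc n)
  have n: "s * complete_homogeneous k n x = complete_homogeneous k n x * s" for k
    using Suc by simp
  have x: "s * x (Suc n) = x (Suc n) * s" using Suc.prems by simp
  show ?case
  proof (induction k)
    case (Suc k)
    have "s * (complete_homogeneous k (Suc n) x * x (Suc n)) = complete_homogeneous k (Suc n) x * x (Suc n) * s"
      by (intro commute_mult Suc x)
    then show ?case by (simp add: complete_homogeneous_Suc_Suc distrib_left distrib_right n)
  qed (simp add: complete_homogeneous_0)
qed

text \<open>
  The hypotheses on \<open>s\<close> are those of the degenerate affine Hecke algebra. They make \<open>s\<close> commute with
  \<open>a + b\<close> and \<open>b a\<close>, hence with every symmetric polynomial in \<open>a\<close> and \<open>b\<close>. Here this is seen from a
  recurrence in which \<open>a\<close> and \<open>b\<close> occur only in these two combinations.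
\<close>
lemma complete_homogeneous_commute_adjacent:
  fixes x :: "nat \<Rightarrow> 'a :: ring_1" and n :: nat
  defines "a \<equiv> x (Suc n)" and "b \<equiv> x (Suc (Suc n))"
  assumes s: "\<And>i. i \<in> {1..n} \<Longrightarrow> s * x i = x i * s"
    and sa: "s * a = b * s - 1" and sb: "s * b = a * s + 1" and ab: "a * b = b * a"
  shows "s * complete_homogeneous k (Suc (Suc n)) x = complete_homogeneous k (Suc (Suc n)) x * s"
proof -
  define A B C where "A k = complete_homogeneous k n x"
    and "B k = complete_homogeneous k (Suc n) x"
    and "C k = complete_homogeneous k (Suc (Suc n)) x" for k
  have B: "B (Suc k) = A (Suc k) + B k * a" and C: "C (Suc k) = B (Suc k) + C k * b" for k
    by (simp_all add: A_def B_def C_def a_def b_def complete_homogeneous_Suc_Suc[of _ n] complete_homogeneous_Suc_Suc[of _ "Suc n"])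
  have A: "s * A k = A k * s" for k
    unfolding A_def by (rule complete_homogeneous_commute[OF s])
  have sum: "s * (a + b) = (a + b) * s" by (simp add: distrib_left distrib_right sa sb)
  have prod: "s * (b * a) = (b * a) * s"
  proof -
    have "s * (b * a) = (s * b) * a" by (simp only: mult.assoc)
    also have "\<dots> = a * (s * a) + a" by (simp add: sb distrib_right mult.assoc)
    also have "\<dots> = a * b * s" by (simp add: sa right_diff_distrib mult.assoc)
    finally show ?thesis by (simp only: ab)
  qed
  have "s * C k = C k * s \<and> s * C (Suc k) = C (Suc k) * s"
  proof (induction k)
    case 0
    have "C 1 = A 1 + (a + b)" using B[of 0] C[of 0] by (simp add: B_def C_def complete_homogeneous_0)
    then have "s * C 1 = C 1 * s" using A[of 1] sum by (simp only: distrib_left distrib_right)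
    then show ?case by (simp add: C_def complete_homogeneous_0)
  next
    case (Suc k)
    \<comment> \<open>The identity \<open>C(t) (1 - b t) (1 - a t) = A(t)\<close> of generating functions, coefficientwise.\<close>
    have "C (Suc (Suc k)) = A (Suc (Suc k)) + C (Suc k) * (a + b) - C k * (b * a)"
      unfolding C[of "Suc k"] B[of "Suc k"] by (simp add: C[of k] algebra_simps)
    moreover have "s * (C (Suc k) * (a + b)) = C (Suc k) * (a + b) * s"
      using Suc by (intro commute_mult[OF _ sum]) auto
    moreover have "s * (C k * (b * a)) = C k * (b * a) * s"
      using Suc by (intro commute_mult[OF _ prod]) auto
    ultimately have "s * C (Suc (Suc k)) = C (Suc (Suc k)) * s"
      using A[of "Suc (Suc k)"] by (simp only: distrib_left distrib_right left_diff_distrib right_diff_distrib)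
    then show ?case using Suc by simp
  qed
  then show ?thesis by (simp add: C_def)
qed

lemma times_swap: "w * \<langle>a \<leftrightarrow> b\<rangle> = \<langle>w \<langle>$\<rangle> a \<leftrightarrow> w \<langle>$\<rangle> b\<rangle> * w"
proof (rule perm_eqI)
  fix x
  have "(\<langle>w \<langle>$\<rangle> a \<leftrightarrow> w \<langle>$\<rangle> b\<rangle>) \<langle>$\<rangle> (w \<langle>$\<rangle> x) = w \<langle>$\<rangle> x" if "x \<noteq> a" "x \<noteq> b"
    using that by (intro apply_swap_same) (auto simp: apply_inj)
  then show "(w * \<langle>a \<leftrightarrow> b\<rangle>) \<langle>$\<rangle> x = (\<langle>w \<langle>$\<rangle> a \<leftrightarrow> w \<langle>$\<rangle> b\<rangle> * w) \<langle>$\<rangle> x"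
    by (cases "x = a"; cases "x = b") (simp_all add: apply_times)
qed

lemma basis_times_jucys_murphy:
  "basis w * jucys_murphy m = (\<Sum>j\<in>{1..<m}. basis \<langle>w \<langle>$\<rangle> j \<leftrightarrow> w \<langle>$\<rangle> m\<rangle>) * basis w"
  by (simp only: jucys_murphy_def sum_distrib_left sum_distrib_right basis_mult times_swap[of w])

lemma basis_commute_jucys_murphy:
  assumes "w \<langle>$\<rangle> m = m" "apply w ` {1..<m} = {1..<m}"
  shows "basis w * jucys_murphy m = jucys_murphy m * basis w"
proof -
  have "(\<Sum>j\<in>{1..<m}. basis \<langle>w \<langle>$\<rangle> j \<leftrightarrow> w \<langle>$\<rangle> m\<rangle>) = (\<Sum>j\<in>apply w ` {1..<m}. basis \<langle>j \<leftrightarrow> m\<rangle>)"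
    by (subst sum.reindex) (auto simp: assms(1) inj_on_def apply_inj)
  then show ?thesis unfolding basis_times_jucys_murphy assms(2) by (simp only: jucys_murphy_def)
qed

lemma basis_swap_commute_jucys_murphy:
  assumes "a \<in> {1..<m} \<and> b \<in> {1..<m} \<or> a > m \<and> b > m"
  shows "basis \<langle>a \<leftrightarrow> b\<rangle> * jucys_murphy m = jucys_murphy m * basis \<langle>a \<leftrightarrow> b\<rangle>"
proof (rule basis_commute_jucys_murphy)
  show "\<langle>a \<leftrightarrow> b\<rangle> \<langle>$\<rangle> m = m" using assms by (intro apply_swap_same) auto
  show "apply \<langle>a \<leftrightarrow> b\<rangle> ` {1..<m} = {1..<m}"
  proof (rule endo_inj_surj)
    show "apply \<langle>a \<leftrightarrow> b\<rangle> ` {1..<m} \<subseteq> {1..<m}"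
    proof (rule image_subsetI)
      fix x assume "x \<in> {1..<m}"
      then show "\<langle>a \<leftrightarrow> b\<rangle> \<langle>$\<rangle> x \<in> {1..<m}"
        using assms by (cases "x = a"; cases "x = b") auto
    qed
  qed (auto simp: inj_on_def apply_inj)
qed

lemma jucys_murphy_commute:
  assumes "m < l"
  shows "jucys_murphy m * jucys_murphy l = jucys_murphy l * jucys_murphy m"
proof -
  have "basis \<langle>j \<leftrightarrow> m\<rangle> * jucys_murphy l = jucys_murphy l * basis \<langle>j \<leftrightarrow> m\<rangle>" if "j \<in> {1..<m}" for j
    using that assms by (intro basis_swap_commute_jucys_murphy) auto
  then show ?thesis unfolding jucys_murphy_def[of m] by (simp add: sum_distrib_left sum_distrib_right)
qed

text \<open>
  Conjugation by \<open>(m, m+1)\<close> turns \<open>J\<^sub>m\<close> into \<open>J\<^bsub>m+1\<^esub>\<close> without its last term, which is \<open>(m, m+1)\<close> itself.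
\<close>
lemma adjacent_swap_times_jucys_murphy:
  assumes "m \<ge> 1"
  defines "s \<equiv> basis \<langle>m \<leftrightarrow> Suc m\<rangle>"
  shows "s * jucys_murphy m = jucys_murphy (Suc m) * s - 1"
    and "s * jucys_murphy (Suc m) = jucys_murphy m * s + 1"
proof -
  have ss: "s * s = 1" by (simp add: s_def basis_mult basis_one)
  have "s * jucys_murphy m = (\<Sum>j\<in>{1..<m}. basis \<langle>j \<leftrightarrow> Suc m\<rangle>) * s"
    unfolding s_def basis_times_jucys_murphy by (intro arg_cong2[where f="(*)"] sum.cong refl) simp
  also have "(\<Sum>j\<in>{1..<m}. basis \<langle>j \<leftrightarrow> Suc m\<rangle>) = jucys_murphy (Suc m) - s"
    using assms(1) by (simp add: jucys_murphy_def s_def)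
  finally show *: "s * jucys_murphy m = jucys_murphy (Suc m) * s - 1"
    by (simp add: left_diff_distrib ss)
  have "jucys_murphy m * s = s * (s * jucys_murphy m) * s"
    by (simp only: mult.assoc[symmetric] ss mult_1_left)
  also have "\<dots> = s * jucys_murphy (Suc m) * (s * s) - s * s"
    unfolding * by (simp only: left_diff_distrib right_diff_distrib mult.assoc mult_1_right)
  finally show "s * jucys_murphy (Suc m) = jucys_murphy m * s + 1"
    by (simp add: ss)
qed

text \<open>
  Transpositions of points up to \<open>n\<close> commute with \<open>h\<^sub>k(n)\<close> by induction and with the last
  Jucys-Murphy element. The adjacent transposition \<open>(n, n+1)\<close> commutes with the earlier Jucys-Murphy
  elements and satisfies the Hecke relations with the last two. Every other transposition
  \<open>(a, n+1)\<close> is a product of these.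
\<close>
lemma complete_homogeneous_jucys_murphy_central:
  assumes "a \<in> {1..n}" "b \<in> {1..n}"
  shows "basis \<langle>a \<leftrightarrow> b\<rangle> * complete_homogeneous k n jucys_murphy = complete_homogeneous k n jucys_murphy * basis \<langle>a \<leftrightarrow> b\<rangle>"
  using assms
proof (induction n arbitrary: a b k)
  case (Suc n)
  note IH = Suc.IH
  let ?h = "\<lambda>k. complete_homogeneous k (Suc n) jucys_murphy"
  let ?\<sigma> = "\<lambda>a b. basis \<langle>a \<leftrightarrow> b\<rangle> :: nat perm group_algebra"
  have small: "?\<sigma> a b * ?h k = ?h k * ?\<sigma> a b" if ab: "a \<in> {1..n}" "b \<in> {1..n}" for a b k
  proof (induction k)
    case (Suc k)
    have J: "?\<sigma> a b * jucys_murphy (Suc n) = jucys_murphy (Suc n) * ?\<sigma> a b"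
      using ab by (intro basis_swap_commute_jucys_murphy) auto
    have "?\<sigma> a b * (?h k * jucys_murphy (Suc n)) = ?h k * jucys_murphy (Suc n) * ?\<sigma> a b"
      by (intro commute_mult Suc J)
    then show ?case using IH[OF ab, of "Suc k"]
      by (simp only: complete_homogeneous_Suc_Suc distrib_left distrib_right)
  qed (simp add: complete_homogeneous_0)
  have adjacent: "?\<sigma> n (Suc n) * ?h k = ?h k * ?\<sigma> n (Suc n)" if n: "n \<ge> 1" for k
  proof -
    obtain m where m: "n = Suc m" using n by (cases n) auto
    show ?thesis unfolding m
    proof (rule complete_homogeneous_commute_adjacent)
      show "?\<sigma> (Suc m) (Suc (Suc m)) * jucys_murphy i = jucys_murphy i * ?\<sigma> (Suc m) (Suc (Suc m))" if "i \<in> {1..m}" for i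
        using that by (intro basis_swap_commute_jucys_murphy) auto
    qed (use adjacent_swap_times_jucys_murphy[of "Suc m"] jucys_murphy_commute[of "Suc m" "Suc (Suc m)"] in auto)
  qed
  have top: "?\<sigma> a (Suc n) * ?h k = ?h k * ?\<sigma> a (Suc n)" if a: "a \<in> {1..n}" for a k
  proof (cases "a = n")
    case True
    then show ?thesis using adjacent a by simp
  next
    case False
    then have "\<langle>a \<leftrightarrow> Suc n\<rangle> = \<langle>a \<leftrightarrow> n\<rangle> * \<langle>n \<leftrightarrow> Suc n\<rangle> * \<langle>a \<leftrightarrow> n\<rangle>"
      using a by (simp add: times_swap[of "\<langle>a \<leftrightarrow> n\<rangle>" n] mult.assoc)
    then have eq: "?\<sigma> a (Suc n) = ?\<sigma> a n * ?\<sigma> n (Suc n) * ?\<sigma> a n"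
      by (simp add: basis_mult)
    have c: "?h k * ?\<sigma> a n = ?\<sigma> a n * ?h k" "?h k * ?\<sigma> n (Suc n) = ?\<sigma> n (Suc n) * ?h k"
      using a by (intro small[symmetric] adjacent[symmetric]; auto)+
    show ?thesis unfolding eq by (rule commute_mult[OF commute_mult[OF c] c(1), symmetric])
  qed
  consider "a = b" | "a \<in> {1..n}" "b \<in> {1..n}" | "a \<in> {1..n}" "b = Suc n" | "a = Suc n" "b \<in> {1..n}"
    using Suc.prems by force
  then show ?case
    by cases (use small top in \<open>simp_all add: basis_one swap_sym[of "Suc n"]\<close>)
qed simp

lemma lookup_complete_homogeneous_conjugate:
  assumes "a \<in> {1..n}" "b \<in> {1..n}"
  shows "Poly_Mapping.lookup (complete_homogeneous k n jucys_murphy) (Additive (\<langle>a \<leftrightarrow> b\<rangle> * w * \<langle>a \<leftrightarrow> b\<rangle>)) =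
         Poly_Mapping.lookup (complete_homogeneous k n jucys_murphy) (Additive w)"
proof -
  let ?h = "complete_homogeneous k n jucys_murphy"
  let ?s = "basis \<langle>a \<leftrightarrow> b\<rangle>"
  have "Poly_Mapping.lookup (?s * ?h) (Additive (w * \<langle>a \<leftrightarrow> b\<rangle>)) =
        Poly_Mapping.lookup (?h * ?s) (Additive (w * \<langle>a \<leftrightarrow> b\<rangle>))"
    by (simp only: complete_homogeneous_jucys_murphy_central[OF assms])
  then show ?thesis by (simp add: lookup_basis_times lookup_times_basis mult.assoc)
qed

section \<open>The coefficients as functions of the cycle type\<close>

abbreviation h_coeff :: "nat \<Rightarrow> nat \<Rightarrow> nat perm \<Rightarrow> complex" where
  "h_coeff k n w \<equiv> Poly_Mapping.lookup (complete_homogeneous k n jucys_murphy) (Additive w)"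

lemma h_coeff_0: "h_coeff 0 n w = of_bool (w = 1)"
  by (auto simp: complete_homogeneous_0 basis_one[symmetric] lookup_basis)

lemma h_coeff_Suc_0: "h_coeff (Suc k) 0 w = 0"
  by (simp add: complete_homogeneous_Suc_0)

lemma h_coeff_Suc_Suc:
  "h_coeff (Suc k) (Suc n) w =
     h_coeff (Suc k) n w + (\<Sum>j\<in>{1..Suc n} - {Suc n}. h_coeff k (Suc n) (w * \<langle>Suc n \<leftrightarrow> j\<rangle>))"
proof -
  have "{1..<Suc n} = {1..Suc n} - {Suc n}" by auto
  then show ?thesis
    by (simp only: complete_homogeneous_Suc_Suc jucys_murphy_def sum_distrib_left lookup_add lookup_sum
        lookup_times_basis inverse_swap swap_sym[of "Suc n"])
qed

lemma h_coeff_outside: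
  assumes "w \<notin> sym_group n"
  shows "h_coeff k n w = 0"
  using complete_homogeneous_in_sym_algebra[of k n] assms
  by (auto simp: sym_algebra_def Poly_Mapping.in_keys_iff)

lemma h_coeff_Rats: "h_coeff k n w \<in> \<rat>"
proof (induction k arbitrary: n w)
  case (Suc k)
  show ?case
    by (induction n arbitrary: w) (auto simp: h_coeff_Suc_0 h_coeff_Suc_Suc intro!: Rats_add Rats_sum Suc)
qed (simp add: h_coeff_0)

text \<open>
  The value \<open>a\<^sub>k(\<mu>)\<close> at an arbitrary permutation of cycle type \<open>\<mu>\<close>; it is rational since all
  coefficients of \<open>h\<^sub>k\<close> are.
\<close>
definition class_coeff :: "nat \<Rightarrow> nat multiset \<Rightarrow> rat" where
  "class_coeff k \<mu> = (SOME q. \<exists>w \<in> sym_group (weight \<mu>).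
     cycle_type (weight \<mu>) w = \<mu> \<and> h_coeff k (weight \<mu>) w = of_rat q)"

lemma h_coeff_eq_class_coeffI:
  assumes wd: "\<And>v. v \<in> sym_group n \<Longrightarrow> cycle_type n v = cycle_type n w \<Longrightarrow> h_coeff k n v = h_coeff k n w"
    and w: "w \<in> sym_group n"
  shows "h_coeff k n w = of_rat (class_coeff k (cycle_type n w))"
proof -
  define \<mu> where "\<mu> = cycle_type n w"
  have n: "n = weight \<mu>" using weight_cycle_type[OF w] by (simp add: \<mu>_def)
  obtain q where "h_coeff k n w = of_rat q" using h_coeff_Rats by (rule Rats_cases)
  then have "\<exists>q. \<exists>v \<in> sym_group (weight \<mu>). cycle_type (weight \<mu>) v = \<mu> \<and> h_coeff k (weight \<mu>) v = of_rat q"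
    unfolding n[symmetric] using w \<mu>_def[symmetric] by blast
  from someI_ex[OF this, folded class_coeff_def] obtain v where v: "v \<in> sym_group (weight \<mu>)"
    "cycle_type (weight \<mu>) v = \<mu>" "h_coeff k (weight \<mu>) v = of_rat (class_coeff k \<mu>)"
    by (elim bexE conjE)
  then have "h_coeff k n v = h_coeff k n w" by (intro wd) (simp_all only: \<mu>_def weight_cycle_type[OF w])
  then show ?thesis using v(3) by (simp only: \<mu>_def weight_cycle_type[OF w])
qed

lemma h_coeff_step:
  assumes IH: "\<forall>v \<in> sym_group (Suc n). h_coeff k (Suc n) v = of_rat (class_coeff k (cycle_type (Suc n) v))"
    and w: "w \<in> sym_group (Suc n)"
  defines "\<mu> \<equiv> cycle_type (Suc n) w" and "p \<equiv> order w (Suc n)"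
  shows "h_coeff (Suc k) (Suc n) w = h_coeff (Suc k) n w +
    of_rat ((\<Sum>i\<in>{1..<p}. class_coeff k (add_mset i (add_mset (p - i) (\<mu> - {#p#})))) +
            raise_part p (class_coeff k) (\<mu> - {#p#}))"
proof -
  have "(\<Sum>j\<in>{1..Suc n} - {Suc n}. h_coeff k (Suc n) (w * \<langle>Suc n \<leftrightarrow> j\<rangle>)) =
      (\<Sum>j\<in>{1..Suc n} - {Suc n}. of_rat (class_coeff k (cycle_type (Suc n) (w * \<langle>Suc n \<leftrightarrow> j\<rangle>))))"
    using w by (intro sum.cong refl bspec[OF IH] times_in_sym_group swap_in_sym_group) auto
  also have "\<dots> = of_rat (\<Sum>j\<in>{1..Suc n} - {Suc n}. class_coeff k (cycle_type (Suc n) (w * \<langle>Suc n \<leftrightarrow> j\<rangle>)))"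
    by (simp only: of_rat_sum)
  also have "(\<Sum>j\<in>{1..Suc n} - {Suc n}. class_coeff k (cycle_type (Suc n) (w * \<langle>Suc n \<leftrightarrow> j\<rangle>))) =
     (\<Sum>i\<in>{1..<p}. class_coeff k (add_mset i (add_mset (p - i) (\<mu> - {#p#})))) +
     (\<Sum>r\<in>#\<mu> - {#p#}. of_nat r * class_coeff k (add_mset (p + r) (\<mu> - {#p, r#})))"
    unfolding p_def \<mu>_def by (rule sum_cycle_type_times_swap[OF w]) simp
  also have "(\<Sum>r\<in>#\<mu> - {#p#}. of_nat r * class_coeff k (add_mset (p + r) (\<mu> - {#p, r#}))) =
      raise_part p (class_coeff k) (\<mu> - {#p#})"
    by (simp add: raise_part_def add.commute)
  finally show ?thesis by (simp only: h_coeff_Suc_Suc)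
qed

text \<open>Centrality enters here: conjugation by one transposition places the largest point on any given cycle.\<close>
lemma move_to_top:
  assumes w: "w \<in> sym_group (Suc n)" and p: "p \<in># cycle_type (Suc n) w"
  obtains v where "v \<in> sym_group (Suc n)" "cycle_type (Suc n) v = cycle_type (Suc n) w"
    "order v (Suc n) = p" "\<And>k. h_coeff k (Suc n) v = h_coeff k (Suc n) w"
proof -
  obtain b where b: "b \<in> {1..Suc n}" "order w b = p" using p by (rule in_cycle_typeE)
  have n: "Suc n \<in> {1..Suc n}" by simp
  let ?s = "\<langle>Suc n \<leftrightarrow> b\<rangle>"
  have "?s * w * ?s \<in> sym_group (Suc n)"
    by (intro times_in_sym_group swap_in_sym_group w n b)
  then show ?thesis
    using that cycle_type_conjugate_swap[OF n b(1)] order_conjugate_swap[of "Suc n" b w] b(2)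
      lookup_complete_homogeneous_conjugate[OF n b(1)] by blast
qed

text \<open>
  Induction on \<open>k\<close> and then on \<open>n\<close>. Given two permutations of the same cycle type, one of them is
  conjugated such that the largest point lies on cycles of the same length in both. Then the sum over
  transpositions agrees by induction on \<open>k\<close>. The term \<open>h\<^bsub>k+1\<^esub>(n-1)\<close> is \<open>0\<close> on both sides if the
  largest point is moved, and agrees by induction on \<open>n\<close> if it is fixed.
\<close>
lemma h_coeff_eq_class_coeff:
  assumes "w \<in> sym_group n"
  shows "h_coeff k n w = of_rat (class_coeff k (cycle_type n w))"
  using assms
proof (induction k arbitrary: n w)
  case 0
  show ?case
  proof (rule h_coeff_eq_class_coeffI[OF _ 0])
    fix v assume "v \<in> sym_group n" "cycle_type n v = cycle_type n w"
    then show "h_coeff 0 n v = h_coeff 0 n w"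
      using reduced_cycle_type_eq_empty_iff[of v n] reduced_cycle_type_eq_empty_iff[OF 0] by (simp add: h_coeff_0)
  qed
next
  case (Suc k)
  then have IH: "\<forall>w \<in> sym_group n. h_coeff k n w = of_rat (class_coeff k (cycle_type n w))" for n by blast
  have "h_coeff (Suc k) n v = h_coeff (Suc k) n w"
    if "v \<in> sym_group n" "w \<in> sym_group n" "cycle_type n v = cycle_type n w" for n v w
    using that
  proof (induction n arbitrary: v w)
    case 0
    then show ?case by (simp add: h_coeff_Suc_0)
  next
    case (Suc n)
    note step = h_coeff_step[OF IH]
    have "order w (Suc n) \<in># cycle_type (Suc n) v"
      unfolding Suc.prems(3) by (rule order_in_cycle_type) simp
    then obtain u where u: "u \<in> sym_group (Suc n)" "cycle_type (Suc n) u = cycle_type (Suc n) w"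
      "order u (Suc n) = order w (Suc n)" "h_coeff (Suc k) (Suc n) u = h_coeff (Suc k) (Suc n) v"
      using move_to_top[OF Suc.prems(1)] Suc.prems(3) by metis
    have "h_coeff (Suc k) n u = h_coeff (Suc k) n w"
    proof (cases "order w (Suc n) = 1")
      case True
      then have uw: "u \<in> sym_group n" "w \<in> sym_group n"
        using u Suc.prems by (auto intro: sym_group_Suc_fixed)
      then have "cycle_type n u = cycle_type n w" using u(2) by (simp add: cycle_type_Suc)
      then show ?thesis using uw by (rule Suc.IH[rotated 2])
    next
      case False
      then have "u \<notin> sym_group n" "w \<notin> sym_group n" using u(3) order_Suc by metis+
      then show ?thesis by (simp add: h_coeff_outside)
    qed
    then show ?case
      using step[OF u(1)] step[OF Suc.prems(2)] by (simp only: u)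
  qed
  then show ?case using Suc.prems by (intro h_coeff_eq_class_coeffI) blast+
qed

lemma h_coeff_step':
  assumes "w \<in> sym_group (Suc n)"
  defines "\<mu> \<equiv> cycle_type (Suc n) w" and "p \<equiv> order w (Suc n)"
  shows "of_rat (class_coeff (Suc k) \<mu>) = h_coeff (Suc k) n w +
    of_rat ((\<Sum>i\<in>{1..<p}. class_coeff k (add_mset i (add_mset (p - i) (\<mu> - {#p#})))) +
            raise_part p (class_coeff k) (\<mu> - {#p#}))"
  using h_coeff_step[OF _ assms(1), of k] h_coeff_eq_class_coeff[OF assms(1), of "Suc k"] h_coeff_eq_class_coeff
  unfolding \<mu>_def p_def by simp

lemma class_coeff_0:
  assumes "is_partition \<mu>"
  shows "class_coeff 0 \<mu> = of_bool (reduced \<mu> = {#})"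
proof -
  obtain w where w: "w \<in> sym_group (weight \<mu>)" "cycle_type (weight \<mu>) w = \<mu>"
    using cycle_type_surj[OF assms] .
  have "of_rat (class_coeff 0 \<mu>) = (of_bool (reduced \<mu> = {#}) :: complex)"
    using h_coeff_eq_class_coeff[OF w(1), of 0] reduced_cycle_type_eq_empty_iff[OF w(1)]
    by (simp add: w(2) h_coeff_0)
  then show ?thesis by (cases "reduced \<mu> = {#}") simp_all
qed

lemma class_coeff_empty: "class_coeff (Suc k) {#} = 0"
proof -
  have "1 \<in> sym_group 0" by (simp add: sym_group_def)
  from h_coeff_eq_class_coeff[OF this, of "Suc k"] show ?thesis
    by (simp add: cycle_type_def h_coeff_Suc_0)
qed

lemma class_coeff_add_one:
  assumes "is_partition \<mu>"
  shows "class_coeff (Suc k) (add_mset 1 \<mu>) = class_coeff (Suc k) \<mu> + raise_part 1 (class_coeff k) \<mu>"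
proof -
  obtain w where w: "w \<in> sym_group (weight \<mu>)" "cycle_type (weight \<mu>) w = \<mu>"
    using cycle_type_surj[OF assms] .
  note w' = sym_group_Suc[OF w(1)]
  have "of_rat (class_coeff (Suc k) (add_mset 1 \<mu>)) =
      (of_rat (class_coeff (Suc k) \<mu> + raise_part 1 (class_coeff k) \<mu>) :: complex)"
    using h_coeff_step'[OF w', of k] h_coeff_eq_class_coeff[OF w(1), of "Suc k"]
    by (simp add: cycle_type_Suc[OF w(1)] order_Suc[OF w(1)] w(2) of_rat_add)
  then show ?thesis by (simp only: of_rat_eq_iff)
qed

lemma class_coeff_add_part:
  assumes "is_partition \<mu>" "p \<ge> 2"
  shows "class_coeff (Suc k) (add_mset p \<mu>) =
    (\<Sum>i\<in>{1..<p}. class_coeff k (add_mset i (add_mset (p - i) \<mu>))) + raise_part p (class_coeff k) \<mu>"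
proof -
  define n where "n = weight (add_mset p \<mu>) - 1"
  have n: "Suc n = weight (add_mset p \<mu>)" using assms(2) by (simp add: n_def)
  have "is_partition (add_mset p \<mu>)" using assms by simp
  then obtain w where w: "w \<in> sym_group (Suc n)" "cycle_type (Suc n) w = add_mset p \<mu>"
    unfolding n by (rule cycle_type_surj)
  then obtain v where v: "v \<in> sym_group (Suc n)" "cycle_type (Suc n) v = add_mset p \<mu>" "order v (Suc n) = p"
    using move_to_top[OF w(1), of p] by auto
  have "v \<notin> sym_group n" using v(3) assms(2) order_Suc[of v n] by auto
  then have "of_rat (class_coeff (Suc k) (add_mset p \<mu>)) =
      (of_rat ((\<Sum>i\<in>{1..<p}. class_coeff k (add_mset i (add_mset (p - i) \<mu>))) + raise_part p (class_coeff k) \<mu>) :: complex)"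
    using h_coeff_step'[OF v(1), of k]
    by (simp add: v h_coeff_outside)
  then show ?thesis by (simp only: of_rat_eq_iff)
qed

text \<open>In each summand on the left the raised part \<open>r + 1 \<ge> 2\<close> is the one that is split or joined.\<close>
lemma raise_part_class_coeff:
  assumes \<mu>: "is_partition \<mu>"
  shows "raise_part 1 (class_coeff (Suc k)) \<mu> = split_part (class_coeff k) \<mu> + join_parts (class_coeff k) \<mu>"
proof -
  have "class_coeff (Suc k) (add_mset (r + 1) (\<mu> - {#r#})) =
     (\<Sum>i=1..r. class_coeff k (add_mset i (add_mset (r + 1 - i) (\<mu> - {#r#})))) +
     raise_part (r + 1) (class_coeff k) (\<mu> - {#r#})" if "r \<in># \<mu>" for r
  proof -
    have "r \<noteq> 0" using \<mu> that by (metis is_partition_def)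
    moreover have "{1..<r + 1} = {1..r}" by auto
    ultimately show ?thesis using class_coeff_add_part[of "\<mu> - {#r#}" "r + 1" k] \<mu> by simp
  qed
  then have "raise_part 1 (class_coeff (Suc k)) \<mu> = (\<Sum>r\<in>#\<mu>. of_nat r *
     ((\<Sum>i=1..r. class_coeff k (add_mset i (add_mset (r + 1 - i) (\<mu> - {#r#})))) +
     raise_part (r + 1) (class_coeff k) (\<mu> - {#r#})))"
    unfolding raise_part_def[of 1] by (intro sum_mset_cong) simp
  then show ?thesis by (simp only: distrib_left sum_mset.distrib split_part_def join_parts_def)
qed

lemma lookup_scale: "Poly_Mapping.lookup (scale a x) g = a * Poly_Mapping.lookup x g"
  by (simp add: scale_def Poly_Mapping.map.rep_eq when_def)

lemma finite_sym_group: "finite (sym_group n)"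
proof (rule finite_imageD)
  have "apply ` sym_group n \<subseteq> {p. p permutes {1..n}}"
  proof (rule image_subsetI)
    fix w assume "w \<in> sym_group n"
    then have "w \<langle>$\<rangle> x = x" if "x \<notin> {1..n}" for x
      using that in_affected[of x w] by (auto simp: sym_group_def)
    moreover have "bij (apply w)" by simp
    ultimately show "apply w \<in> {p. p permutes {1..n}}" by (simp add: permutes_def bij_iff)
  qed
  then show "finite (apply ` sym_group n)" by (rule finite_subset) (simp add: finite_permutations)
  show "inj_on apply (sym_group n)" by (rule inj_onI) (simp add: perm_eqI)
qed

lemma lookup_class_sum:
  "Poly_Mapping.lookup (class_sum n \<mu>) (Additive w) = of_bool (w \<in> sym_group n \<and> cycle_type n w = \<mu>)"
proof -
  let ?A = "{p. p \<in> sym_group n \<and> cycle_type n p = \<mu>}"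
  have "finite ?A" by (rule finite_subset[OF _ finite_sym_group[of n]]) auto
  then have "(\<Sum>p\<in>?A. if p = w then 1 else 0) = (if w \<in> ?A then 1 else (0::complex))" by (rule sum.delta)
  then show ?thesis by (simp add: class_sum_def lookup_sum lookup_basis of_bool_def)
qed

text \<open>
  A class sum \<open>C\<^sub>\<mu>\<close> occurs once in the claimed expansion for each number \<open>j \<le> m\<^sub>1(\<mu>)\<close> of
  parts \<open>1\<close> of \<open>\<rho>\<close>.
\<close>
lemma completed_preimage:
  assumes "is_partition \<mu>"
  shows "{\<rho>. is_partition \<rho> \<and> weight \<rho> \<le> weight \<mu> \<and> completed (weight \<mu>) \<rho> = \<mu>} =
    (\<lambda>j. reduced \<mu> + replicate_mset j 1) ` {..count \<mu> 1}"
proof (intro subset_antisym subsetI)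
  fix \<rho> assume "\<rho> \<in> {\<rho>. is_partition \<rho> \<and> weight \<rho> \<le> weight \<mu> \<and> completed (weight \<mu>) \<rho> = \<mu>}"
  then have \<mu>_eq: "\<mu> = \<rho> + replicate_mset (weight \<mu> - weight \<rho>) 1" by (simp add: completed_def)
  have "reduced \<mu> = reduced \<rho>"
    using arg_cong[OF \<mu>_eq, of reduced] by (simp only: reduced_plus_replicate)
  moreover have "count \<rho> 1 \<le> count \<mu> 1"
    using arg_cong[OF \<mu>_eq, of "\<lambda>M. count M 1"] by simp
  ultimately show "\<rho> \<in> (\<lambda>j. reduced \<mu> + replicate_mset j 1) ` {..count \<mu> 1}"
    using reduced_plus_ones[of \<rho>] by (intro image_eqI[of _ _ "count \<rho> 1"]) auto
next
  fix \<rho> assume "\<rho> \<in> (\<lambda>j. reduced \<mu> + replicate_mset j 1) ` {..count \<mu> 1}"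
  then obtain j where j: "j \<le> count \<mu> 1" "\<rho> = reduced \<mu> + replicate_mset j 1" by blast
  have "weight \<rho> \<le> weight \<mu>" "weight \<mu> - weight \<rho> = count \<mu> 1 - j"
    using j weight_eq_reduced[of \<mu>] by auto
  moreover have "replicate_mset j 1 + replicate_mset (count \<mu> 1 - j) 1 = replicate_mset (count \<mu> 1) (1::nat)"
    using j(1) by (rule_tac multiset_eqI) simp
  then have "completed (weight \<mu>) \<rho> = \<mu>"
    using reduced_plus_ones[of \<mu>] \<open>weight \<mu> - weight \<rho> = count \<mu> 1 - j\<close> j(2) by (simp add: completed_def add.assoc)
  moreover have "is_partition \<rho>" using assms j(2) by (auto simp: is_partition_def reduced_def)
  ultimately show "\<rho> \<in> {\<rho>. is_partition \<rho> \<and> weight \<rho> \<le> weight \<mu> \<and> completed (weight \<mu>) \<rho> = \<mu>}" by simp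
qed

lemma finite_partitions: "finite {\<rho>. is_partition \<rho> \<and> weight \<rho> \<le> n}"
proof -
  have "{\<rho>. is_partition \<rho> \<and> weight \<rho> \<le> n} \<subseteq> mset ` {xs. set xs \<subseteq> {..n} \<and> length xs \<le> n}"
  proof
    fix \<rho> assume "\<rho> \<in> {\<rho>. is_partition \<rho> \<and> weight \<rho> \<le> n}"
    then have \<rho>: "is_partition \<rho>" "weight \<rho> \<le> n" by auto
    obtain xs where xs: "\<rho> = mset xs" by (metis ex_mset)
    have "size \<rho> \<le> weight \<rho>"
      using \<rho>(1) by (induction \<rho>) (auto simp: Suc_le_eq)
    then have "length xs \<le> n" using \<rho>(2) by (simp add: xs)
    moreover have "set xs \<subseteq> {..n}" using \<rho>(2) le_weight[of _ \<rho>] by (force simp: xs)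
    ultimately show "\<rho> \<in> mset ` {xs. set xs \<subseteq> {..n} \<and> length xs \<le> n}" using xs by blast
  qed
  then show ?thesis by (rule finite_subset) (intro finite_imageI finite_lists_length_le finite_atMost)
qed

lemma lookup_class_expansion:
  fixes f :: "nat multiset \<Rightarrow> rat"
  assumes w: "w \<in> sym_group n"
  shows "Poly_Mapping.lookup (\<Sum>\<rho> | is_partition \<rho> \<and> weight \<rho> \<le> n.
            scale (of_rat (f \<rho>) * of_nat ((n - weight (reduced \<rho>)) choose count \<rho> 1))
              (class_sum n (completed n \<rho>))) (Additive w) = of_rat (ones_transform f (cycle_type n w))"
proof -
  define \<mu> where "\<mu> = cycle_type n w"
  have \<mu>: "is_partition \<mu>" "weight \<mu> = n"
    using is_partition_cycle_type weight_cycle_type[OF w] by (auto simp: \<mu>_def)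
  have top: "n - weight (reduced \<mu>) = count \<mu> 1"
  proof -
    have "weight \<mu> = weight (reduced \<mu>) + count \<mu> 1" by (rule weight_eq_reduced)
    then show ?thesis using \<mu>(2) by simp
  qed
  let ?P = "{\<rho>. is_partition \<rho> \<and> weight \<rho> \<le> n}"
  let ?c = "\<lambda>\<rho>. (of_rat (f \<rho>) * of_nat ((n - weight (reduced \<rho>)) choose count \<rho> 1) :: complex)"
  have "Poly_Mapping.lookup (\<Sum>\<rho>\<in>?P. scale (?c \<rho>) (class_sum n (completed n \<rho>))) (Additive w) =
      (\<Sum>\<rho>\<in>?P. ?c \<rho> * of_bool (completed n \<rho> = \<mu>))"
    using w by (auto simp: lookup_sum lookup_scale lookup_class_sum \<mu>_def intro!: sum.cong)
  also have "\<dots> = (\<Sum>\<rho> | is_partition \<rho> \<and> weight \<rho> \<le> n \<and> completed n \<rho> = \<mu>. ?c \<rho>)"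
    by (intro sum.mono_neutral_cong_right finite_partitions) auto
  also have "\<dots> = (\<Sum>\<rho>\<in>(\<lambda>j. reduced \<mu> + replicate_mset j 1) ` {..count \<mu> 1}. ?c \<rho>)"
    using completed_preimage[OF \<mu>(1)] by (simp only: \<mu>(2))
  also have "\<dots> = (\<Sum>j\<le>count \<mu> 1. ?c (reduced \<mu> + replicate_mset j 1))"
    by (subst sum.reindex) (auto simp: inj_on_def dest: arg_cong[where f=size])
  also have "\<dots> = (\<Sum>j\<le>count \<mu> 1. of_rat (of_nat (count \<mu> 1 choose j) * f (reduced \<mu> + replicate_mset j 1)))"
  proof (rule sum.cong)
    fix j
    have "reduced (reduced \<mu> + replicate_mset j 1) = reduced \<mu>" "count (reduced \<mu> + replicate_mset j 1) 1 = j"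
      by (rule multiset_eqI, simp add: reduced_def) (simp add: reduced_def)
    then show "?c (reduced \<mu> + replicate_mset j 1) =
        of_rat (of_nat (count \<mu> 1 choose j) * f (reduced \<mu> + replicate_mset j 1))"
      by (simp only: top) (simp add: of_rat_mult)
  qed simp
  finally show ?thesis by (simp only: ones_transform_def of_rat_sum \<mu>_def)
qed

theorem theorem7p1:
  "(\<exists>!c :: nat \<Rightarrow> nat multiset \<Rightarrow> rat. recurrence_family c) \<and>
   (\<forall>c. recurrence_family c \<longrightarrow>
     (\<forall>k n. n \<ge> 1 \<longrightarrow>
       complete_homogeneous k n jucys_murphy =
         (\<Sum>\<rho> | is_partition \<rho> \<and> weight \<rho> \<le> n.
            scale (of_rat (c k \<rho>) * of_nat ((n - weight (reduced \<rho>)) choose count \<rho> 1))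
              (class_sum n (completed n \<rho>)))))"
proof -
  obtain c where c: "recurrence_family c"
    and transform: "\<And>k \<mu>. is_partition \<mu> \<Longrightarrow> ones_transform (c k) \<mu> = class_coeff k \<mu>"
    using recurrence_family_exists[of class_coeff, OF class_coeff_0 class_coeff_empty
        class_coeff_add_one raise_part_class_coeff] by blast
  have unique: "d = c" if "recurrence_family d" for d
    using recurrence_family_unique[OF that c] .
  have "complete_homogeneous k n jucys_murphy =
      (\<Sum>\<rho> | is_partition \<rho> \<and> weight \<rho> \<le> n.
         scale (of_rat (c k \<rho>) * of_nat ((n - weight (reduced \<rho>)) choose count \<rho> 1))
           (class_sum n (completed n \<rho>)))" (is "_ = ?rhs") for k n
  proof (rule poly_mapping_eqI)
    fix g :: "nat perm additive"
    obtain w where g: "g = Additive w" by (cases g)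
    show "Poly_Mapping.lookup (complete_homogeneous k n jucys_murphy) g = Poly_Mapping.lookup ?rhs g"
    proof (cases "w \<in> sym_group n")
      case True
      then show ?thesis
        unfolding g lookup_class_expansion[OF True] transform[OF is_partition_cycle_type]
        by (rule h_coeff_eq_class_coeff)
    next
      case False
      then show ?thesis
        by (simp add: g h_coeff_outside lookup_sum lookup_scale lookup_class_sum)
    qed
  qed
  then show ?thesis using c unique by blast
qed

end
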